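(* Let $\Delta\ge3$ be a fixed integer and let $w=w(n)$ satisfy $0<w\le n$. Then, as $n\to\infty$: 1. the number of labelled trees on $[n]$ with maximum degree at most $\Delta$ equals $$t_{\Delta}(n)=(1+o(1))\,\alpha_{\Delta}\sqrt{\frac{\gamma_{\Delta}(\alpha_{\Delta})}{\gamma_{\Delta-2}(\alpha_{\Delta})}}\left(\frac{a_{\Delta}}{e}\right)^n n^{n-2};$$ 2. letting $f_{\Delta}(n,m)$ be the number of labelled rooted forests on $[n]$ with maximum degree at most $\Delta$, with $m$ components, and with every root having degree at most $\Delta-1$, $$\sum_{m=1}^n f_{\Delta}(n,m)\, w^m = (1+o(1))\, w\,\frac{(n-1)!}{r^{n-1}}\,\frac{(\gamma_{\Delta}(r))^{n}e^{r w}}{\sqrt{2\pi\beta(r) n}},$$ where $r=r(n)$ is the unique positive solution of the equation $\frac{x\gamma_{\Delta}'(x)}{\gamma_{\Delta}(x)}+\frac{xw}{n}=1$ and $$\beta(r)=\frac{r^2\gamma''_{\Delta}(r)}{\gamma_{\Delta}(r)}+\frac{2rw}{n}-\frac{r^2w^2}{n^2}.$$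
   Context: For an integer $\Delta\ge2$ let $\gamma_{\Delta}(x)=\sum_{k=0}^{\Delta-1}x^k/k!$ (a polynomial). For $\Delta\ge3$, $\alpha_{\Delta}\in(1,\infty)$ is the unique solution of $x\gamma_{\Delta-1}(x)/\gamma_{\Delta}(x)=1$, and $a_{\Delta}:=\gamma_{\Delta-1}(\alpha_{\Delta})$. A rooted forest is a vertex-disjoint union of trees each having one distinguished vertex (its root). *)

theory Defs
  imports
    Complex_Main
    "HOL-Computational_Algebra.Polynomial"
    "HOL-Library.Landau_Symbols"
begin

section \<open>Graphs, trees and rooted forests\<close>

text \<open>
  A simple undirected graph is given by its vertex set and by its edge set, an edge being a
  two-element set of vertices.
\<close>

definition ugraph :: "'a set \<Rightarrow> 'a set set \<Rightarrow> bool" where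
  "ugraph V E \<longleftrightarrow> finite V \<and> (\<forall>e\<in>E. e \<subseteq> V \<and> card e = 2)"

definition ug_degree :: "'a set set \<Rightarrow> 'a \<Rightarrow> nat" where
  "ug_degree E v = card {e \<in> E. v \<in> e}"

definition ug_joined :: "'a set set \<Rightarrow> 'a \<Rightarrow> 'a \<Rightarrow> bool" where
  "ug_joined E u v \<longleftrightarrow> (u, v) \<in> {(x, y). {x, y} \<in> E}\<^sup>*"

definition ug_connected :: "'a set \<Rightarrow> 'a set set \<Rightarrow> bool" where
  "ug_connected V E \<longleftrightarrow> V \<noteq> {} \<and> (\<forall>u\<in>V. \<forall>v\<in>V. ug_joined E u v)"

text \<open>The successive vertices of a cycle, the last one being adjacent to the first one.\<close>

definition ug_cycle :: "'a set set \<Rightarrow> 'a list \<Rightarrow> bool" where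
  "ug_cycle E vs \<longleftrightarrow> 3 \<le> length vs \<and> distinct vs \<and>
     (\<forall>i<length vs. {vs ! i, vs ! (Suc i mod length vs)} \<in> E)"

definition ug_tree :: "'a set \<Rightarrow> 'a set set \<Rightarrow> bool" where
  "ug_tree V E \<longleftrightarrow> ugraph V E \<and> ug_connected V E \<and> (\<nexists>vs. ug_cycle E vs)"

definition ug_components :: "'a set \<Rightarrow> 'a set set \<Rightarrow> 'a set set" where
  "ug_components V E = V // {(u, v). u \<in> V \<and> v \<in> V \<and> ug_joined E u v}"

text \<open>\<open>R\<close> is the set of roots: every component is a tree and contains exactly one root.\<close>

definition rooted_forest :: "'a set \<Rightarrow> 'a set set \<Rightarrow> 'a set \<Rightarrow> bool" where
  "rooted_forest V E R \<longleftrightarrow> ugraph V E \<and> R \<subseteq> V \<and>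
     (\<forall>C\<in>ug_components V E. ug_tree C {e \<in> E. e \<subseteq> C} \<and> (\<exists>!r. r \<in> R \<and> r \<in> C))"

definition tree_count :: "nat \<Rightarrow> nat \<Rightarrow> nat" where
  "tree_count \<Delta> n =
     card {E. ug_tree {1..n} E \<and> (\<forall>v\<in>{1..n}. ug_degree E v \<le> \<Delta>)}"

definition forest_count :: "nat \<Rightarrow> nat \<Rightarrow> nat \<Rightarrow> nat" where
  "forest_count \<Delta> n m =
     card {(E, R). rooted_forest {1..n} E R \<and> (\<forall>v\<in>{1..n}. ug_degree E v \<le> \<Delta>) \<and>
                   card (ug_components {1..n} E) = m \<and> (\<forall>v\<in>R. ug_degree E v \<le> \<Delta> - 1)}"


section \<open>The truncated exponential and the constants derived from it\<close>

definition gamma_poly :: "nat \<Rightarrow> real poly" where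
  "gamma_poly \<Delta> = (\<Sum>k<\<Delta>. monom (1 / fact k) k)"

definition alpha :: "nat \<Rightarrow> real" where
  "alpha \<Delta> = (THE x. x > 1 \<and> x * poly (gamma_poly (\<Delta> - 1)) x / poly (gamma_poly \<Delta>) x = 1)"

definition a_const :: "nat \<Rightarrow> real" where
  "a_const \<Delta> = poly (gamma_poly (\<Delta> - 1)) (alpha \<Delta>)"

definition saddle :: "nat \<Rightarrow> nat \<Rightarrow> real \<Rightarrow> real" where
  "saddle \<Delta> n w = (THE x. x > 0 \<and>
     x * poly (pderiv (gamma_poly \<Delta>)) x / poly (gamma_poly \<Delta>) x + x * w / real n = 1)"

definition saddle_beta :: "nat \<Rightarrow> nat \<Rightarrow> real \<Rightarrow> real \<Rightarrow> real" where
  "saddle_beta \<Delta> n w r =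
     r\<^sup>2 * poly (pderiv (pderiv (gamma_poly \<Delta>))) r / poly (gamma_poly \<Delta>) r
       + 2 * r * w / real n - r\<^sup>2 * w\<^sup>2 / (real n)\<^sup>2"

text \<open>Both definite descriptions above are proper.\<close>

lemma poly_gamma_poly: "poly (gamma_poly \<Delta>) x = (\<Sum>k<\<Delta>. x ^ k / fact k)"
  by (simp add: gamma_poly_def poly_sum poly_monom)

lemma pderiv_gamma_poly: "pderiv (gamma_poly \<Delta>) = gamma_poly (\<Delta> - 1)"
proof (cases \<Delta>)
  case (Suc d)
  have "pderiv (gamma_poly (Suc d)) = gamma_poly d"
  proof (induction d)
    case (Suc d)
    have "pderiv (gamma_poly (Suc (Suc d))) =
        pderiv (gamma_poly (Suc d)) + pderiv (monom (1 / fact (Suc d)) (Suc d))"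
      by (simp add: gamma_poly_def pderiv_add)
    also have "pderiv (monom (1 / fact (Suc d)) (Suc d)) = (monom (1 / fact d) d :: real poly)"
      by (simp add: pderiv_monom field_simps del: of_nat_Suc)
    finally show ?case
      by (simp add: Suc.IH) (simp add: gamma_poly_def)
  qed (simp add: gamma_poly_def pderiv_monom)
  then show ?thesis by (simp add: Suc)
qed (simp add: gamma_poly_def)

lemma poly_gamma_poly_pos:
  assumes "\<Delta> \<ge> 1" "x \<ge> 0"
  shows "poly (gamma_poly \<Delta>) x > 0"
proof -
  have "(\<Sum>k\<in>{0::nat}. x ^ k / fact k) \<le> (\<Sum>k<\<Delta>. x ^ k / fact k)"
    using assms by (intro sum_mono2) auto
  then show ?thesis by (simp add: poly_gamma_poly)
qed

lemma ex1_root_aux: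
  fixes c :: real
  assumes "\<Delta> \<ge> 3" "c \<ge> 0"
  shows "\<exists>!x. x > 0 \<and>
    x * poly (pderiv (gamma_poly \<Delta>)) x / poly (gamma_poly \<Delta>) x + x * c = 1"
proof -
  define G where "G x = x * poly (pderiv (gamma_poly \<Delta>)) x - poly (gamma_poly \<Delta>) x
      + c * x * poly (gamma_poly \<Delta>) x" for x :: real
  obtain d where d: "\<Delta> = Suc d" "d \<ge> 2"
    using assms by (cases \<Delta>) auto
  have sum_eq: "x * poly (pderiv (gamma_poly \<Delta>)) x - poly (gamma_poly \<Delta>) x
      = (\<Sum>k<\<Delta>. (real k - 1) * x ^ k / fact k)" for x :: real
  proof -
    have "x * poly (pderiv (gamma_poly \<Delta>)) x = (\<Sum>k<d. real (Suc k) * x ^ Suc k / fact (Suc k))"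
      unfolding pderiv_gamma_poly
      by (simp add: d poly_gamma_poly sum_distrib_left)
    also have "\<dots> = (\<Sum>k<\<Delta>. real k * x ^ k / fact k)"
      unfolding d by (subst sum.lessThan_Suc_shift) simp
    finally show ?thesis
      by (simp add: poly_gamma_poly sum_subtractf [symmetric] diff_divide_distrib algebra_simps)
  qed
  have mono: "G x < G y" if "0 \<le> x" "x < y" for x y
  proof -
    have le: "(real k - 1) * x ^ k / fact k \<le> (real k - 1) * y ^ k / fact k" for k
      using that by (cases "k = 0") (auto intro!: divide_right_mono mult_left_mono power_mono)
    have "(\<Sum>k<\<Delta>. (real k - 1) * x ^ k / fact k) < (\<Sum>k<\<Delta>. (real k - 1) * y ^ k / fact k)"
    proof (rule sum_strict_mono_ex1)
      have "(real 2 - 1) * x ^ 2 / fact 2 < (real 2 - 1) * y ^ 2 / fact 2"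
        using that by (intro divide_strict_right_mono mult_strict_left_mono power_strict_mono) auto
      then show "\<exists>k\<in>{..<\<Delta>}. (real k - 1) * x ^ k / fact k < (real k - 1) * y ^ k / fact k"
        using d by (intro bexI [of _ 2]) auto
    qed (use le in auto)
    moreover have "c * x * poly (gamma_poly \<Delta>) x \<le> c * y * poly (gamma_poly \<Delta>) y"
      using that assms poly_gamma_poly_pos [of \<Delta> x]
      by (intro mult_mono) (auto simp: poly_gamma_poly intro!: sum_mono divide_right_mono power_mono)
    ultimately show ?thesis unfolding G_def sum_eq by linarith
  qed
  have eq_iff: "x * poly (pderiv (gamma_poly \<Delta>)) x / poly (gamma_poly \<Delta>) x + x * c = 1 \<longleftrightarrow> G x = 0"
    if "x > 0" for x
  proof -
    define p where "p = poly (gamma_poly \<Delta>) x"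
    define q where "q = x * poly (pderiv (gamma_poly \<Delta>)) x"
    have "p \<noteq> 0"
      using poly_gamma_poly_pos [of \<Delta> x] that assms by (simp add: p_def)
    then have "(q / p + x * c - 1) * p = q - p + c * x * p"
      by (simp add: algebra_simps)
    then have "q / p + x * c - 1 = 0 \<longleftrightarrow> q - p + c * x * p = 0"
      using \<open>p \<noteq> 0\<close> by (metis mult_eq_0_iff)
    then show ?thesis
      by (simp add: G_def flip: p_def q_def)
  qed
  have "G 0 < 0"
    using poly_gamma_poly_pos [of \<Delta> 0] assms by (simp add: G_def)
  moreover have "G 2 > 0"
  proof -
    have "(\<Sum>k\<in>{0::nat, 1, 2}. (real k - 1) * 2 ^ k / fact k)
        \<le> (\<Sum>k<\<Delta>. (real k - 1) * 2 ^ k / fact k)"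
      using d by (intro sum_mono2) (auto intro!: divide_nonneg_nonneg mult_nonneg_nonneg)
    moreover have "(\<Sum>k\<in>{0::nat, 1, 2}. (real k - 1) * 2 ^ k / fact k) = (1 :: real)"
      by (simp add: fact_numeral)
    moreover have "c * 2 * poly (gamma_poly \<Delta>) 2 \<ge> 0"
      using assms poly_gamma_poly_pos [of \<Delta> 2] by simp
    ultimately show ?thesis unfolding G_def sum_eq by linarith
  qed
  moreover have "\<forall>x. 0 \<le> x \<and> x \<le> 2 \<longrightarrow> isCont G x"
    unfolding G_def by (intro allI impI continuous_intros)
  ultimately obtain x where x: "0 \<le> x" "G x = 0"
    using IVT [of G 0 0 2] by auto
  with \<open>G 0 < 0\<close> have "x > 0" by (cases "x = 0") auto
  show ?thesis
  proof (rule ex1I [of _ x])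
    fix y assume y: "y > 0 \<and> y * poly (pderiv (gamma_poly \<Delta>)) y / poly (gamma_poly \<Delta>) y + y * c = 1"
    then have "G y = 0" using eq_iff by blast
    then show "y = x"
      using mono [of x y] mono [of y x] x y by (cases x y rule: linorder_cases) auto
  qed (use x \<open>x > 0\<close> eq_iff in auto)
qed

lemma saddle_ex1:
  assumes "\<Delta> \<ge> 3" "w > 0"
  shows "\<exists>!x. x > 0 \<and>
    x * poly (pderiv (gamma_poly \<Delta>)) x / poly (gamma_poly \<Delta>) x + x * w / real n = 1"
  using ex1_root_aux [of \<Delta> "w / real n"] assms by simp

lemma alpha_ex1:
  assumes "\<Delta> \<ge> 3"
  shows "\<exists>!x. x > 1 \<and> x * poly (gamma_poly (\<Delta> - 1)) x / poly (gamma_poly \<Delta>) x = 1"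
proof -
  obtain d where d: "\<Delta> = Suc d" "d \<ge> 2"
    using assms by (cases \<Delta>) auto
  have gt1: "x > 1"
    if "x > 0" "x * poly (gamma_poly (\<Delta> - 1)) x / poly (gamma_poly \<Delta>) x = 1" for x
  proof (rule ccontr)
    assume "\<not> x > 1"
    then have "x * poly (gamma_poly d) x \<le> 1 * poly (gamma_poly d) x"
      using poly_gamma_poly_pos [of d x] d that by (intro mult_right_mono) auto
    also have "\<dots> < poly (gamma_poly \<Delta>) x"
      using that(1) d by (simp add: poly_gamma_poly)
    finally have "x * poly (gamma_poly (\<Delta> - 1)) x < poly (gamma_poly \<Delta>) x"
      by (simp add: d)
    then show False
      using that(2) by (cases "poly (gamma_poly \<Delta>) x = 0") auto
  qed
  define P where "P x \<longleftrightarrow> x > 0 \<and> x * poly (gamma_poly (\<Delta> - 1)) x / poly (gamma_poly \<Delta>) x = 1" for x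
  have "\<exists>!x. P x"
    using ex1_root_aux [OF assms, of 0] by (simp add: P_def pderiv_gamma_poly)
  moreover have "x > 1 \<and> x * poly (gamma_poly (\<Delta> - 1)) x / poly (gamma_poly \<Delta>) x = 1 \<longleftrightarrow> P x" for x
    unfolding P_def using gt1 [of x] by (meson less_trans zero_less_one)
  ultimately show ?thesis
    by (simp only:)
qed

end

theory Submission
  imports Defs
    "HOL-Library.Transitive_Closure_Table"
    "HOL-Complex_Analysis.Complex_Analysis"
    "HOL-Probability.Probability"
    "HOL-Real_Asymp.Real_Asymp"
begin

text \<open>
  Deleting a root \<open>v\<close> of a rooted forest and promoting its neighbours to roots is a bijection onto
  pairs of a set \<open>C\<close> of nonroots and a forest on \<open>V - {v}\<close> with roots \<open>R - {v} \<union> C\<close>; under it the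
  degree bound \<open>\<Delta> - 1\<close> for roots and \<open>\<Delta>\<close> for other vertices is preserved. By induction, the number
  \<open>N\<close> of such forests with \<open>m\<close> given roots and \<open>u\<close> other vertices satisfies
  \<open>(u + m) N = m u! [x^u] \<gamma>(x)^(u + m)\<close>. This expresses both counts through coefficients
  \<open>[x^(n - j)] \<gamma>(x)^n exp (w x)\<close>, with \<open>w = 0\<close>, \<open>j = 2\<close> for trees and \<open>j = 1\<close> for the weighted sum over
  forests.

  By Cauchy's formula on the circle of radius \<open>r\<close> such a coefficient is, up to an explicit factor,
  the integral of the \<open>n\<close>-th power of the characteristic function of \<open>X + Y - 1\<close>, where \<open>X\<close> has weights
  proportional to \<open>r^k / k!\<close> for \<open>k < \<Delta>\<close> and \<open>Y\<close> is Poisson with mean \<open>r w / n\<close>. The saddle point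
  equation says that this variable is centred, and its variance is \<open>\<beta>(r)\<close>. Since \<open>r\<close> stays in
  \<open>[1/2, 2]\<close>, the Gaussian approximation and the decay of the characteristic function are uniform,
  and dominated convergence gives the local limit theorem. Stirling's formula is the case of a
  Poisson variable alone.
\<close>

section \<open>Rooted forests\<close>

lemma ug_joined_refl [simp]: "ug_joined E u u"
  by (simp add: ug_joined_def)

lemma ug_joined_sym:
  assumes "ug_joined E u v"
  shows "ug_joined E v u"
proof -
  have "sym ({(x, y). {x, y} \<in> E}\<^sup>*)"
    by (rule sym_rtrancl) (simp add: sym_def insert_commute)
  then show ?thesis
    using assms unfolding ug_joined_def by (rule symD)
qed

lemma ug_joined_trans: "ug_joined E u v \<Longrightarrow> ug_joined E v w \<Longrightarrow> ug_joined E u w"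
  unfolding ug_joined_def by (rule rtrancl_trans)

lemma ug_joined_edge: "{u, v} \<in> E \<Longrightarrow> ug_joined E u v"
  unfolding ug_joined_def by auto

lemma ug_joined_mono:
  assumes "ug_joined E u v" "E \<subseteq> F"
  shows "ug_joined F u v"
proof -
  have "{(x, y). {x, y} \<in> E}\<^sup>* \<subseteq> {(x, y). {x, y} \<in> F}\<^sup>*"
    by (rule rtrancl_mono) (use assms(2) in blast)
  then show ?thesis
    using assms(1) unfolding ug_joined_def by (rule subsetD)
qed

lemma ug_joined_induct [consumes 1, case_names refl step]:
  assumes "ug_joined E u v" "P u"
    and "\<And>x y. ug_joined E u x \<Longrightarrow> {x, y} \<in> E \<Longrightarrow> P x \<Longrightarrow> P y"
  shows "P v"
  using assms(1) unfolding ug_joined_def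
proof (induction rule: rtrancl_induct)
  case (step x y)
  then show ?case
    using assms(3)[of x y] by (simp add: ug_joined_def)
qed (rule assms(2))

lemma ugraph_edgeD:
  assumes "ugraph V E" "{x, y} \<in> E"
  shows "x \<in> V" "y \<in> V" "x \<noteq> y"
proof -
  have e: "{x, y} \<subseteq> V" "card {x, y} = 2"
    using assms unfolding ugraph_def by blast+
  show "x \<in> V" "y \<in> V" using e(1) by simp_all
  show "x \<noteq> y"
  proof
    assume "x = y"
    then show False using e(2) by simp
  qed
qed

lemma ug_cycle_joined:
  assumes "ug_cycle E vs" "i < length vs"
  shows "ug_joined E (vs ! 0) (vs ! i)"
  using assms(2)
proof (induction i)
  case (Suc i)
  then have "{vs ! i, vs ! (Suc i mod length vs)} \<in> E"
    using assms(1) unfolding ug_cycle_def by (meson Suc_lessD)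
  then have "{vs ! i, vs ! Suc i} \<in> E"
    using Suc.prems by simp
  then show ?case
    using Suc ug_joined_trans ug_joined_edge Suc_lessD by metis
qed auto

lemma ug_cycle_mono: "ug_cycle E vs \<Longrightarrow> E \<subseteq> F \<Longrightarrow> ug_cycle F vs"
  unfolding ug_cycle_def by auto

section \<open>Rooted forests described without reference to components\<close>

text \<open>Equivalent to \<open>rooted_forest\<close> by \<open>rooted_forest_iff\<close>. All
  conditions concern the whole graph, so the effect of removing or adding the edges at one vertex
  can be followed without recomputing components.\<close>

definition forest_rooted_at :: "'a set \<Rightarrow> 'a set set \<Rightarrow> 'a set \<Rightarrow> bool" where
  "forest_rooted_at V E R \<longleftrightarrow> ugraph V E \<and> R \<subseteq> V \<and>
     (\<forall>u\<in>V. \<exists>!r. r \<in> R \<and> ug_joined E u r) \<and> (\<nexists>vs. ug_cycle E vs)"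

lemma ug_components_eq:
  "ug_components V E = (\<lambda>u. {v \<in> V. ug_joined E u v}) ` V"
  unfolding ug_components_def quotient_def by auto

text \<open>A path starting at \<open>u\<close> meets only vertices joined to \<open>u\<close>,
  hence uses only edges inside the component of \<open>u\<close>.\<close>

lemma ug_joined_component:
  assumes "ugraph V E" "u \<in> V" "ug_joined E u v"
  defines "K \<equiv> {v \<in> V. ug_joined E u v}"
  shows "ug_joined {e \<in> E. e \<subseteq> K} u v"
  using assms(3)
proof (induction rule: ug_joined_induct)
  case (step x y)
  have "x \<in> K" "y \<in> K"
    using step ugraph_edgeD[OF assms(1)] ug_joined_trans[OF step(1) ug_joined_edge[OF step(2)]]
    by (auto simp: K_def)
  then have "{x, y} \<in> {e \<in> E. e \<subseteq> K}"
    using step by auto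
  then have "ug_joined {e \<in> E. e \<subseteq> K} x y"
    by (rule ug_joined_edge)
  with step.IH show ?case
    by (rule ug_joined_trans)
qed auto

text \<open>Components are connected by construction, so asking them to be trees is asking them to
  be acyclic. Since the vertices of a cycle are all joined to each other, every cycle lies in one
  component, and acyclicity of all components amounts to acyclicity of the graph.\<close>

lemma rooted_forest_iff: "rooted_forest V E R \<longleftrightarrow> forest_rooted_at V E R"
proof (cases "ugraph V E \<and> R \<subseteq> V")
  case True
  define K where "K u = {v \<in> V. ug_joined E u v}" for u
  have ug: "ugraph (K u) {e \<in> E. e \<subseteq> K u}" for u
    using True by (auto simp: ugraph_def K_def)
  have conn: "ug_connected (K u) {e \<in> E. e \<subseteq> K u}" if "u \<in> V" for u
    unfolding ug_connected_def
  proof (intro conjI ballI)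
    show "K u \<noteq> {}" using that by (auto simp: K_def)
    fix x y assume "x \<in> K u" "y \<in> K u"
    then show "ug_joined {e \<in> E. e \<subseteq> K u} x y"
      using ug_joined_component[of V E u x] ug_joined_component[of V E u y] True that
      unfolding K_def by (metis (lifting) ug_joined_sym ug_joined_trans mem_Collect_eq)
  qed
  have cyc: "(\<exists>u\<in>V. \<exists>vs. ug_cycle {e \<in> E. e \<subseteq> K u} vs) \<longleftrightarrow> (\<exists>vs. ug_cycle E vs)"
  proof
    assume "\<exists>vs. ug_cycle E vs"
    then obtain vs where vs: "ug_cycle E vs" by blast
    let ?n = "length vs"
    have len: "?n \<ge> 3" using vs by (simp add: ug_cycle_def)
    have edge: "{vs ! i, vs ! (Suc i mod ?n)} \<in> E" if "i < ?n" for i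
      using vs that unfolding ug_cycle_def by blast
    have inK: "vs ! i \<in> K (vs ! 0)" if "i < ?n" for i
      using ug_cycle_joined[OF vs that] ugraph_edgeD(1)[OF _ edge[OF that]] True
      by (auto simp: K_def)
    have "ug_cycle {e \<in> E. e \<subseteq> K (vs ! 0)} vs"
      unfolding ug_cycle_def
    proof (intro conjI allI impI)
      fix i assume "i < ?n"
      moreover have "Suc i mod ?n < ?n" using len by (intro mod_less_divisor) auto
      ultimately show "{vs ! i, vs ! (Suc i mod ?n)} \<in> {e \<in> E. e \<subseteq> K (vs ! 0)}"
        using edge inK by auto
    qed (use vs in \<open>auto simp: ug_cycle_def\<close>)
    moreover have "vs ! 0 \<in> V" using inK[of 0] len by (cases vs) (auto simp: K_def)
    ultimately show "\<exists>u\<in>V. \<exists>vs. ug_cycle {e \<in> E. e \<subseteq> K u} vs" by blast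
  next
    assume "\<exists>u\<in>V. \<exists>vs. ug_cycle {e \<in> E. e \<subseteq> K u} vs"
    then obtain u vs where "ug_cycle {e \<in> E. e \<subseteq> K u} vs" by blast
    then have "ug_cycle E vs" by (rule ug_cycle_mono) blast
    then show "\<exists>vs. ug_cycle E vs" ..
  qed
  have root: "(\<exists>!r. r \<in> R \<and> r \<in> K u) \<longleftrightarrow> (\<exists>!r. r \<in> R \<and> ug_joined E u r)" for u
  proof -
    have "r \<in> R \<and> r \<in> K u \<longleftrightarrow> r \<in> R \<and> ug_joined E u r" for r
      using True by (auto simp: K_def)
    then show ?thesis by simp
  qed
  have "rooted_forest V E R \<longleftrightarrow>
      (\<forall>u\<in>V. (\<nexists>vs. ug_cycle {e \<in> E. e \<subseteq> K u} vs) \<and> (\<exists>!r. r \<in> R \<and> r \<in> K u))"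
    unfolding rooted_forest_def ug_components_eq K_def[symmetric]
    using True conn ug by (simp add: ug_tree_def)
  also have "\<dots> \<longleftrightarrow> (\<nexists>vs. ug_cycle E vs) \<and> (\<forall>u\<in>V. \<exists>!r. r \<in> R \<and> ug_joined E u r)"
    unfolding root cyc[symmetric] by blast
  finally show ?thesis
    unfolding forest_rooted_at_def using True by blast
qed (auto simp: rooted_forest_def forest_rooted_at_def)

text \<open>With a single root, having a unique reachable root is just being joined to
  \<open>v\<close>, and this is connectedness because being joined is symmetric and
  transitive.\<close>

lemma ug_tree_iff:
  assumes "v \<in> V"
  shows "ug_tree V E \<longleftrightarrow> forest_rooted_at V E {v}"
proof -
  have "(\<forall>u\<in>V. \<forall>w\<in>V. ug_joined E u w) \<longleftrightarrow> (\<forall>u\<in>V. ug_joined E u v)"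
    using assms by (meson ug_joined_sym ug_joined_trans)
  moreover have "(\<exists>!r. r \<in> {v} \<and> ug_joined E u r) \<longleftrightarrow> ug_joined E u v" for u
    by auto
  ultimately show ?thesis
    using assms unfolding ug_tree_def forest_rooted_at_def ug_connected_def by auto
qed

text \<open>Sending a root to its component is a bijection: existence of a reachable root gives
  surjectivity, its uniqueness gives injectivity.\<close>

lemma card_ug_components:
  assumes "forest_rooted_at V E R"
  shows "card (ug_components V E) = card R"
proof -
  let ?K = "\<lambda>u. {v \<in> V. ug_joined E u v}"
  have *: "\<exists>!r. r \<in> R \<and> ug_joined E u r" if "u \<in> V" for u
    using assms that by (auto simp: forest_rooted_at_def)
  have RV: "R \<subseteq> V" using assms by (auto simp: forest_rooted_at_def)
  have "?K ` V = ?K ` R"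
  proof
    show "?K ` V \<subseteq> ?K ` R"
    proof
      fix A assume "A \<in> ?K ` V"
      then obtain u where u: "u \<in> V" "A = ?K u" by auto
      then obtain r where r: "r \<in> R" "ug_joined E u r" using * by blast
      then have "A = ?K r" using u by (auto dest: ug_joined_sym intro: ug_joined_trans)
      then show "A \<in> ?K ` R" using r by blast
    qed
  qed (use RV in auto)
  moreover have "inj_on ?K R"
  proof (rule inj_onI)
    fix r s assume rs: "r \<in> R" "s \<in> R" "?K r = ?K s"
    have "r \<in> V" "s \<in> ?K s" using rs RV by auto
    then have "s \<in> ?K r" by (simp only: rs(3))
    then have "ug_joined E r s" by simp
    with *[OF \<open>r \<in> V\<close>] rs(1,2) show "r = s" by auto
  qed
  ultimately show ?thesis by (simp add: ug_components_eq card_image)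
qed

section \<open>Cycles through a given vertex\<close>

text \<open>A path from \<open>a\<close> to \<open>b\<close> that avoids \<open>v\<close> is closed
  up to a cycle by the two edges at \<open>v\<close>.\<close>

lemma ug_cycle_of_joined_neighbours:
  assumes "{v, a} \<in> E" "{v, b} \<in> E" "a \<noteq> b" "a \<noteq> v" "ug_joined {e \<in> E. v \<notin> e} a b"
  shows "\<exists>vs. ug_cycle E vs"
proof -
  define adj where "adj = (\<lambda>x y. {x, y} \<in> E \<and> v \<notin> {x, y})"
  have "{(x, y). {x, y} \<in> {e \<in> E. v \<notin> e}} = {(x, y). adj x y}"
    by (simp add: adj_def)
  then have "adj\<^sup>*\<^sup>* a b"
    using assms(5) unfolding ug_joined_def rtranclp_rtrancl_eq by simp
  \<comment> \<open>The path is shortened to one without repetitions, as \<open>ug_cycle\<close>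
    requires. The list \<open>xs\<close> omits the starting point \<open>a\<close> and ends with
    \<open>b\<close>.\<close>
  then obtain xs where xs: "rtrancl_path adj a xs b" "distinct (a # xs)"
    unfolding rtranclp_eq_rtrancl_path by (metis rtrancl_path_distinct)
  have ne: "xs \<noteq> []"
    using xs(1) assms(3) by (auto elim: rtrancl_path.cases)
  have edge: "{(a # xs) ! i, xs ! i} \<in> E" "v \<noteq> xs ! i" if "i < length xs" for i
    using rtrancl_path_nth[OF xs(1) that] by (auto simp: adj_def)
  have lst: "xs ! (length xs - 1) = b"
    using rtrancl_path_last[OF xs(1) ne] ne by (simp add: last_conv_nth)
  have "v \<notin> set xs"
    using edge(2) by (auto simp: in_set_conv_nth)
  have "ug_cycle E (v # a # xs)"
    unfolding ug_cycle_def
  proof (intro conjI allI impI)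
    show "3 \<le> length (v # a # xs)" using ne by (cases xs) auto
    show "distinct (v # a # xs)" using xs(2) \<open>v \<notin> set xs\<close> assms(4) by auto
    fix i assume i: "i < length (v # a # xs)"
    consider "i = 0" | j where "i = Suc j" "j < length xs" | "i = Suc (length xs)"
      using i by (cases i) (auto simp: less_Suc_eq)
    then show "{(v # a # xs) ! i, (v # a # xs) ! (Suc i mod length (v # a # xs))} \<in> E"
    proof cases
      case 1
      then show ?thesis using assms(1) by simp
    next
      case (2 j)
      then show ?thesis using edge(1)[of j] by simp
    next
      case 3
      have "(a # xs) ! length xs = b"
        using lst ne by (cases xs) auto
      then show ?thesis using assms(2) 3 by (simp add: insert_commute)
    qed
  qed
  then show ?thesis ..
qed

text \<open>Converse of the previous construction: the two neighbours of \<open>v\<close> on the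
  cycle are joined by the rest of the cycle, which does not return to \<open>v\<close>.\<close>

lemma ug_joined_neighbours_of_cycle:
  assumes "ug_cycle E vs" "v \<in> set vs"
  shows "\<exists>a b. {v, a} \<in> E \<and> {v, b} \<in> E \<and> a \<noteq> b \<and> ug_joined {e \<in> E. v \<notin> e} a b"
proof -
  define n where "n = length vs"
  obtain i where i: "i < n" "v = vs ! i"
    using assms(2) by (auto simp: in_set_conv_nth n_def)
  have n: "n \<ge> 3" and dist: "distinct vs" and
    edge: "\<And>i. i < n \<Longrightarrow> {vs ! i, vs ! (Suc i mod n)} \<in> E"
    using assms(1) by (auto simp: ug_cycle_def n_def)
  have lt: "m mod n < n" for m using n by simp
  have ix: "vs ! j = vs ! k \<longleftrightarrow> j = k" if "j < n" "k < n" for j k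
    using dist that by (simp add: n_def nth_eq_iff_index_eq)
  have ne: "(i + Suc k) mod n \<noteq> i" if "Suc k < n" for k
    using i that by (auto simp: mod_if)
  \<comment> \<open>Walking along the cycle from the successor of \<open>v\<close>; the condition
    \<open>Suc k < n\<close> stops the walk before it comes back to position
    \<open>i\<close>.\<close>
  have joined: "ug_joined {e \<in> E. v \<notin> e} (vs ! ((i + 1) mod n)) (vs ! ((i + Suc k) mod n))"
    if "Suc k < n" for k
    using that
  proof (induction k)
    case (Suc k)
    let ?p = "(i + Suc k) mod n" and ?q = "(i + Suc (Suc k)) mod n"
    have "?q = Suc ?p mod n" by (simp add: mod_Suc_eq)
    then have "{vs ! ?p, vs ! ?q} \<in> E" using edge[OF lt] by metis
    moreover have "vs ! ?p \<noteq> v" "vs ! ?q \<noteq> v"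
      using ne[of k] ne[of "Suc k"] Suc.prems ix[OF lt i(1)] i(2) by auto
    ultimately have pq: "ug_joined {e \<in> E. v \<notin> e} (vs ! ?p) (vs ! ?q)"
      by (intro ug_joined_edge) auto
    show ?case
      by (rule ug_joined_trans[OF Suc.IH pq]) (use Suc.prems in simp)
  qed simp
  \<comment> \<open>The index \<open>i + Suc (n - 2)\<close> is \<open>i - 1\<close> modulo
    \<open>n\<close>, so \<open>?a\<close> and \<open>?b\<close> are the successor and the
    predecessor of \<open>v\<close>.\<close>
  let ?a = "vs ! ((i + 1) mod n)" and ?b = "vs ! ((i + Suc (n - 2)) mod n)"
  have "{v, ?a} \<in> E" using edge[OF i(1)] i(2) by simp
  moreover have "{v, ?b} \<in> E"
  proof -
    have "Suc ((i + Suc (n - 2)) mod n) mod n = Suc (i + Suc (n - 2)) mod n"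
      by (rule mod_Suc_eq)
    also have "Suc (i + Suc (n - 2)) = i + n" using n by simp
    finally have "Suc ((i + Suc (n - 2)) mod n) mod n = (i + n) mod n" .
    then show ?thesis
      using edge[OF lt[of "i + Suc (n - 2)"]] i by (simp add: insert_commute)
  qed
  moreover have "?a \<noteq> ?b"
  proof -
    have "(i + 1) mod n \<noteq> (i + Suc (n - 2)) mod n"
      using i n by (auto simp: mod_if)
    then show ?thesis using ix[OF lt lt] by blast
  qed
  moreover have "ug_joined {e \<in> E. v \<notin> e} ?a ?b"
    using joined[of "n - 2"] n by simp
  ultimately show ?thesis by blast
qed

section \<open>Deleting a root and adding it back\<close>

text \<open>Each neighbour of \<open>v\<close> becomes the root of its branch. Two new roots in one
  component would give two old roots joined in \<open>E\<close>, possibly through \<open>v\<close>,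
  or two neighbours of \<open>v\<close> joined without \<open>v\<close>, hence a cycle.\<close>

lemma forest_delete_root:
  assumes "forest_rooted_at V E R" "v \<in> R"
  defines "C \<equiv> {u. {v, u} \<in> E}" and "E' \<equiv> {e \<in> E. v \<notin> e}"
  shows "C \<subseteq> V - R" "forest_rooted_at (V - {v}) E' (R - {v} \<union> C)"
proof -
  have ug: "ugraph V E" and RV: "R \<subseteq> V" and acyc: "\<nexists>vs. ug_cycle E vs"
    using assms(1) by (auto simp: forest_rooted_at_def)
  have ex1: "\<exists>!r. r \<in> R \<and> ug_joined E u r" if "u \<in> V" for u
    using assms(1) that by (auto simp: forest_rooted_at_def)
  have uniq: "r = s" if "r \<in> R" "s \<in> R" "ug_joined E r s" for r s
  proof -
    have "r \<in> V" using RV that by auto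
    from ex1[OF this] that show ?thesis by auto
  qed
  have E'E: "E' \<subseteq> E" by (auto simp: E'_def)
  have CV: "u \<in> V" "u \<noteq> v" "ug_joined E v u" if "u \<in> C" for u
  proof -
    have e: "{v, u} \<in> E" using that by (simp add: C_def)
    show "u \<in> V" "u \<noteq> v" "ug_joined E v u"
      using ugraph_edgeD[OF ug e] ug_joined_edge[OF e] by simp_all
  qed
  show CR: "C \<subseteq> V - R"
  proof
    fix u assume u: "u \<in> C"
    have "u \<notin> R"
      using uniq[OF assms(2) _ CV(3)[OF u]] CV(2)[OF u] by auto
    then show "u \<in> V - R" using CV(1)[OF u] by auto
  qed
  \<comment> \<open>A path from \<open>u\<close> either avoids \<open>v\<close>, or its part before
    the first visit to \<open>v\<close> ends in a neighbour of \<open>v\<close>, that is, in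
    \<open>C\<close>.\<close>
  have dec: "(w \<noteq> v \<and> ug_joined E' u w) \<or> (\<exists>c\<in>C. ug_joined E' u c)"
    if "ug_joined E u w" "u \<noteq> v" for u w
    using that(1)
  proof (induction rule: ug_joined_induct)
    case (step x y)
    show ?case
    proof (cases "\<exists>c\<in>C. ug_joined E' u c")
      case False
      then have x: "x \<noteq> v" "ug_joined E' u x" using step.IH by auto
      have "y \<noteq> v"
        using False x step.hyps(2) by (auto simp: C_def insert_commute)
      then have "{x, y} \<in> E'" using x step.hyps(2) by (simp add: E'_def)
      then show ?thesis
        using x \<open>y \<noteq> v\<close> ug_joined_trans[OF _ ug_joined_edge] by metis
    qed auto
  qed (use that(2) in simp)
  show "forest_rooted_at (V - {v}) E' (R - {v} \<union> C)"
    unfolding forest_rooted_at_def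
  proof (intro conjI ballI)
    show "ugraph (V - {v}) E'" using ug by (auto simp: ugraph_def E'_def)
    show "R - {v} \<union> C \<subseteq> V - {v}" using RV CV by auto
    show "\<nexists>vs. ug_cycle E' vs" using acyc ug_cycle_mono[OF _ E'E] by blast
    fix u assume u: "u \<in> V - {v}"
    obtain r where r: "r \<in> R" "ug_joined E u r" using ex1[of u] u by auto
    have "\<exists>r. r \<in> R - {v} \<union> C \<and> ug_joined E' u r"
      using dec[OF r(2)] u r by auto
    moreover have "r = s"
      if rs: "r \<in> R - {v} \<union> C" "s \<in> R - {v} \<union> C" and "ug_joined E' u r" "ug_joined E' u s" for r s
    proof (rule ccontr)
      assume "r \<noteq> s"
      have j: "ug_joined E' r s" using that ug_joined_sym ug_joined_trans by metis
      then have jE: "ug_joined E r s" "ug_joined E s r"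
        using ug_joined_mono[OF _ E'E] ug_joined_sym by metis+
      consider "r \<in> R" "s \<in> R" | "r \<in> R - {v}" "s \<in> C" | "s \<in> R - {v}" "r \<in> C" | "r \<in> C" "s \<in> C"
        using rs by blast
      then show False
      proof cases
        case 1
        then show False using uniq jE \<open>r \<noteq> s\<close> by blast
      next
        case 2
        have "ug_joined E r v" using jE(1) CV(3)[OF 2(2)] ug_joined_sym ug_joined_trans by metis
        then show False using uniq[of r v] 2 assms(2) by auto
      next
        case 3
        have "ug_joined E s v" using jE(2) CV(3)[OF 3(2)] ug_joined_sym ug_joined_trans by metis
        then show False using uniq[of s v] 3 assms(2) by auto
      next
        case 4
        then have "\<exists>vs. ug_cycle E vs"
          using ug_cycle_of_joined_neighbours[of v r E s] \<open>r \<noteq> s\<close> j CV(2)[of r]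
          by (auto simp: C_def E'_def)
        then show False using acyc by blast
      qed
    qed
    ultimately show "\<exists>!r. r \<in> R - {v} \<union> C \<and> ug_joined E' u r" by blast
  qed
qed

text \<open>Uniqueness of roots comes from a function that is constant along the edges of the new
  graph and fixes every root. A cycle avoiding \<open>v\<close> would be a cycle of the old forest,
  and a cycle through \<open>v\<close> would join two old roots.\<close>

lemma forest_add_root:
  assumes F: "forest_rooted_at (V - {v}) E' (R - {v} \<union> C)" and "v \<in> R" "R \<subseteq> V" "C \<subseteq> V - R"
    and "finite V"
  shows "forest_rooted_at V (E' \<union> (\<lambda>u. {v, u}) ` C) R"
proof -
  define E where "E = E' \<union> (\<lambda>u. {v, u}) ` C"
  define R' where "R' = R - {v} \<union> C"
  have ug': "ugraph (V - {v}) E'" and acyc: "\<nexists>vs. ug_cycle E' vs"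
    using F by (auto simp: forest_rooted_at_def)
  have ex1: "\<exists>!r. r \<in> R' \<and> ug_joined E' u r" if "u \<in> V - {v}" for u
    using F that unfolding forest_rooted_at_def R'_def by blast
  have R'V: "R' \<subseteq> V - {v}" using assms by (auto simp: R'_def)
  have vC: "v \<notin> C" using assms by auto
  have vE': "v \<notin> e" if "e \<in> E'" for e using ug' that by (auto simp: ugraph_def)
  have nbr: "{v, u} \<in> E \<longleftrightarrow> u \<in> C" for u
    using vE' vC by (auto simp: E_def doubleton_eq_iff)
  have E'_eq: "{e \<in> E. v \<notin> e} = E'" using vE' by (auto simp: E_def)
  have E'E: "E' \<subseteq> E" by (auto simp: E_def)
  \<comment> \<open>The root of \<open>u\<close> in the old forest; the description is proper by
    \<open>ex1\<close> for \<open>u\<close> other than \<open>v\<close>.\<close>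
  define \<rho> where "\<rho> u = (THE r. r \<in> R' \<and> ug_joined E' u r)" for u
  have \<rho>: "\<rho> u \<in> R'" "ug_joined E' u (\<rho> u)" if "u \<in> V - {v}" for u
    using theI'[OF ex1[OF that]] by (auto simp: \<rho>_def)
  have \<rho>_eq: "\<rho> u = r" if "u \<in> V - {v}" "r \<in> R'" "ug_joined E' u r" for u r
    using ex1[OF that(1)] \<rho>[OF that(1)] that(2,3) by auto
  define \<sigma> where "\<sigma> u = (if u = v \<or> \<rho> u \<in> C then v else \<rho> u)" for u
  have \<sigma>_root: "\<sigma> r = r" if "r \<in> R" for r
  proof (cases "r = v")
    case False
    then have "r \<in> R'" using that by (auto simp: R'_def)
    then have "\<rho> r = r" using R'V by (intro \<rho>_eq) auto
    then show ?thesis using that assms(4) by (auto simp: \<sigma>_def)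
  qed (simp add: \<sigma>_def)
  have \<sigma>_C: "\<sigma> c = v" if "c \<in> C" for c
  proof -
    have "c \<in> R'" using that by (auto simp: R'_def)
    then have "\<rho> c = c" using R'V by (intro \<rho>_eq) auto
    then show ?thesis using that by (auto simp: \<sigma>_def)
  qed
  have \<sigma>_edge: "\<sigma> x = \<sigma> y" if xy: "{x, y} \<in> E" for x y
  proof (cases "{x, y} \<in> E'")
    case True
    have xy: "x \<in> V - {v}" "y \<in> V - {v}" using ugraph_edgeD[OF ug' True] by auto
    have "ug_joined E' x (\<rho> y)"
      using ug_joined_trans[OF ug_joined_edge[OF True] \<rho>(2)[OF xy(2)]] .
    then have "\<rho> x = \<rho> y" by (intro \<rho>_eq xy \<rho>)
    then show ?thesis using xy by (auto simp: \<sigma>_def)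
  next
    case False
    then obtain c where "c \<in> C" "{x, y} = {v, c}" using xy unfolding E_def by blast
    then have "x = v \<and> y = c \<or> x = c \<and> y = v" by (auto simp: doubleton_eq_iff)
    moreover have "\<sigma> v = v" by (simp add: \<sigma>_def)
    ultimately show ?thesis using \<sigma>_C[OF \<open>c \<in> C\<close>] by auto
  qed
  have \<sigma>_joined: "\<sigma> x = \<sigma> y" if "ug_joined E x y" for x y
    using that
  proof (induction rule: ug_joined_induct)
    case (step a b)
    then show ?case using \<sigma>_edge by metis
  qed simp
  have "forest_rooted_at V E R"
    unfolding forest_rooted_at_def
  proof (intro conjI ballI)
    show "ugraph V E"
      unfolding ugraph_def
    proof (intro conjI ballI assms(5))
      fix e assume "e \<in> E"
      then consider "e \<in> E'" | c where "c \<in> C" "e = {v, c}" by (auto simp: E_def)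
      then show "e \<subseteq> V" "card e = 2"
      proof (atomize(full), cases)
        case 1
        then show "e \<subseteq> V \<and> card e = 2" using ug' by (auto simp: ugraph_def)
      next
        case 2
        then have "c \<noteq> v" using vC by auto
        then show "e \<subseteq> V \<and> card e = 2" using 2 assms by auto
      qed
    qed
    show "R \<subseteq> V" by fact
    fix u assume u: "u \<in> V"
    have "\<exists>r. r \<in> R \<and> ug_joined E u r"
    proof (cases "u = v")
      case False
      then have u': "u \<in> V - {v}" using u by auto
      have j: "ug_joined E u (\<rho> u)" using ug_joined_mono[OF \<rho>(2)[OF u'] E'E] .
      show ?thesis
      proof (cases "\<rho> u \<in> C")
        case True
        then have "ug_joined E (\<rho> u) v" using nbr ug_joined_edge ug_joined_sym by metis
        then show ?thesis using j ug_joined_trans assms(2) by metis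
      next
        case False
        then show ?thesis using \<rho>(1)[OF u'] j by (auto simp: R'_def)
      qed
    qed (use assms(2) in auto)
    moreover have "r = s" if "r \<in> R" "s \<in> R" "ug_joined E u r" "ug_joined E u s" for r s
      using \<sigma>_joined[OF that(3)] \<sigma>_joined[OF that(4)] \<sigma>_root that by simp
    ultimately show "\<exists>!r. r \<in> R \<and> ug_joined E u r" by blast
  next
    show "\<nexists>vs. ug_cycle E vs"
    proof
      assume "\<exists>vs. ug_cycle E vs"
      then obtain vs where vs: "ug_cycle E vs" ..
      show False
      proof (cases "v \<in> set vs")
        case True
        \<comment> \<open>The neighbours of \<open>v\<close> on the cycle are two distinct elements
          of \<open>C\<close>, both old roots, joined in \<open>E'\<close>; this contradicts the
          uniqueness of old roots.\<close>
        then obtain a b where ab: "a \<in> C" "b \<in> C" "a \<noteq> b" "ug_joined E' a b"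
          using ug_joined_neighbours_of_cycle[OF vs True] unfolding nbr E'_eq by blast
        then have "a \<in> R'" "b \<in> R'" by (auto simp: R'_def)
        moreover from this have "a \<in> V - {v}" using R'V by auto
        ultimately show False using \<rho>_eq[of a a] \<rho>_eq[of a b] ab by auto
      next
        case False
        have "ug_cycle E' vs"
          unfolding ug_cycle_def
        proof (intro conjI allI impI)
          fix i assume i: "i < length vs"
          then have "{vs ! i, vs ! (Suc i mod length vs)} \<in> E"
            using vs unfolding ug_cycle_def by blast
          moreover have "Suc i mod length vs < length vs" using i by (intro mod_less_divisor) auto
          then have "vs ! i \<in> set vs" "vs ! (Suc i mod length vs) \<in> set vs"
            using i nth_mem by blast+
          then have "v \<notin> {vs ! i, vs ! (Suc i mod length vs)}"
            using False by auto
          ultimately show "{vs ! i, vs ! (Suc i mod length vs)} \<in> E'"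
            unfolding E'_eq[symmetric] by blast
        qed (use vs in \<open>auto simp: ug_cycle_def\<close>)
        then show False using acyc by blast
      qed
    qed
  qed
  then show ?thesis by (simp add: E_def)
qed

section \<open>Counting forests by deleting roots\<close>

text \<open>The bound may vary with the vertex: roots and nonroots are treated differently, and a
  neighbour of a deleted root loses one edge, so its bound drops by one.\<close>

definition bounded_forests :: "('a \<Rightarrow> nat) \<Rightarrow> 'a set \<Rightarrow> 'a set \<Rightarrow> 'a set set set" where
  "bounded_forests b V R = {E. forest_rooted_at V E R \<and> (\<forall>u\<in>V. ug_degree E u \<le> b u)}"

lemma finite_bounded_forests:
  assumes "finite V"
  shows "finite (bounded_forests b V R)"
  by (rule finite_subset[of _ "Pow (Pow V)"])
     (use assms in \<open>auto simp: bounded_forests_def forest_rooted_at_def ugraph_def\<close>)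

lemma bounded_forests_cong:
  assumes "\<And>u. u \<in> V \<Longrightarrow> b u = b' u"
  shows "bounded_forests b V R = bounded_forests b' V R"
  using assms by (simp add: bounded_forests_def cong: conj_cong)

lemma ug_degree_star:
  assumes "finite E'" "\<And>e. e \<in> E' \<Longrightarrow> v \<notin> e" "v \<notin> C"
  defines "E \<equiv> E' \<union> (\<lambda>u. {v, u}) ` C"
  shows "ug_degree E v = card C"
    and "u \<noteq> v \<Longrightarrow> ug_degree E u = ug_degree E' u + (if u \<in> C then 1 else 0)"
proof -
  have "{e \<in> E. v \<in> e} = (\<lambda>u. {v, u}) ` C"
    using assms by (auto simp: E_def)
  moreover have "inj_on (\<lambda>u. {v, u}) C"
    by (auto simp: inj_on_def doubleton_eq_iff)
  ultimately show "ug_degree E v = card C"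
    by (simp add: ug_degree_def card_image)
  assume u: "u \<noteq> v"
  have "{e \<in> E. u \<in> e} = {e \<in> E'. u \<in> e} \<union> (if u \<in> C then {{v, u}} else {})"
    using u by (auto simp: E_def)
  moreover have "{v, u} \<notin> E'" using assms(2) by blast
  ultimately show "ug_degree E u = ug_degree E' u + (if u \<in> C then 1 else 0)"
    using assms(1) by (simp add: ug_degree_def)
qed

text \<open>Deletion and addition of the root \<open>v\<close> are inverse bijections between
  forests and pairs of a neighbour set \<open>C\<close> and a smaller forest. The bounds of nonroots
  must be positive because \<open>b u - 1\<close> is truncated at zero, whereas a member of
  \<open>C\<close> has at least the edge to \<open>v\<close>.\<close>

lemma card_bounded_forests_delete_root:
  assumes "finite V" "R \<subseteq> V" "v \<in> R" and b: "\<And>u. u \<in> V - R \<Longrightarrow> b u \<ge> 1"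
  shows "card (bounded_forests b V R) =
    (\<Sum>C | C \<subseteq> V - R \<and> card C \<le> b v.
      card (bounded_forests (\<lambda>u. if u \<in> C then b u - 1 else b u) (V - {v}) (R - {v} \<union> C)))"
proof -
  define I where "I = {C. C \<subseteq> V - R \<and> card C \<le> b v}"
  define b' where "b' C u = (if u \<in> C then b u - 1 else b u)" for C u
  define G where "G C = bounded_forests (b' C) (V - {v}) (R - {v} \<union> C)" for C
  have vV: "v \<in> V" using assms by auto
  have finI: "finite I" using assms(1) by (auto simp: I_def)
  have v_notin: "v \<notin> e" if "E' \<in> G C" "e \<in> E'" for E' C e
    using that by (auto simp: G_def bounded_forests_def forest_rooted_at_def ugraph_def)
  have finE: "finite E" if "forest_rooted_at W E S" for W E and S :: "'a set"
    using that by (auto simp: forest_rooted_at_def ugraph_def intro: finite_subset[of E "Pow W"])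
  define f where "f = (\<lambda>(C, E'). E' \<union> (\<lambda>u. {v, u}) ` C)"
  define g where "g E = ({u. {v, u} \<in> E}, {e \<in> E. v \<notin> e})" for E
  have star: "E = {e \<in> E. v \<notin> e} \<union> (\<lambda>u. {v, u}) ` {u. {v, u} \<in> E}" if "forest_rooted_at V E R" for E
  proof -
    have "\<exists>u. e = {v, u}" if "e \<in> E" "v \<in> e" for e
    proof -
      have "card e = 2" using that \<open>forest_rooted_at V E R\<close> by (auto simp: forest_rooted_at_def ugraph_def)
      then show ?thesis using that(2) by (auto simp: card_2_iff)
    qed
    then show ?thesis by blast
  qed
  have "bij_betw f (SIGMA C:I. G C) (bounded_forests b V R)"
  proof (rule bij_betw_byWitness[where f' = g])
    show "\<forall>x\<in>(SIGMA C:I. G C). g (f x) = x"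
    proof
      fix x assume "x \<in> (SIGMA C:I. G C)"
      then obtain C E' where x: "x = (C, E')" "C \<in> I" "E' \<in> G C" by auto
      have "v \<notin> C" using x(2) assms(3) by (auto simp: I_def)
      then show "g (f x) = x"
        using v_notin[OF x(3)] by (auto simp: x(1) f_def g_def doubleton_eq_iff)
    qed
    show "\<forall>E\<in>bounded_forests b V R. f (g E) = E"
      using star by (auto simp: f_def g_def bounded_forests_def)
    show "f ` (SIGMA C:I. G C) \<subseteq> bounded_forests b V R"
    proof
      fix E assume "E \<in> f ` (SIGMA C:I. G C)"
      then obtain C E' where x: "C \<in> I" "E' \<in> G C" "E = E' \<union> (\<lambda>u. {v, u}) ` C"
        by (auto simp: f_def)
      have F: "forest_rooted_at (V - {v}) E' (R - {v} \<union> C)"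
        and deg': "\<And>u. u \<in> V - {v} \<Longrightarrow> ug_degree E' u \<le> b' C u"
        using x(2) by (auto simp: G_def bounded_forests_def)
      have C: "C \<subseteq> V - R" "card C \<le> b v" using x(1) by (auto simp: I_def)
      have vC: "v \<notin> C" using C assms(3) by auto
      have "forest_rooted_at V E R"
        unfolding x(3) by (rule forest_add_root[OF F assms(3,2) C(1) assms(1)])
      moreover have "ug_degree E u \<le> b u" if "u \<in> V" for u
      proof (cases "u = v")
        case True
        then show ?thesis
          using ug_degree_star(1)[OF finE[OF F] v_notin[OF x(2)] vC] C(2) x(3) by simp
      next
        case False
        then show ?thesis
          using ug_degree_star(2)[OF finE[OF F] v_notin[OF x(2)] vC False] deg'[of u] that
            b[of u] C(1) x(3) by (auto simp: b'_def split: if_splits)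
      qed
      ultimately show "E \<in> bounded_forests b V R" by (simp add: bounded_forests_def)
    qed
    show "g ` bounded_forests b V R \<subseteq> (SIGMA C:I. G C)"
    proof
      fix x assume "x \<in> g ` bounded_forests b V R"
      then obtain E where E: "E \<in> bounded_forests b V R" "x = g E" by auto
      define C where "C = {u. {v, u} \<in> E}"
      define E' where "E' = {e \<in> E. v \<notin> e}"
      have x: "x = (C, E')" using E(2) by (simp add: g_def C_def E'_def)
      have F: "forest_rooted_at V E R" and deg: "\<And>u. u \<in> V \<Longrightarrow> ug_degree E u \<le> b u"
        using E(1) by (auto simp: bounded_forests_def)
      have del: "C \<subseteq> V - R" "forest_rooted_at (V - {v}) E' (R - {v} \<union> C)"
        using forest_delete_root[OF F assms(3)] by (simp_all add: C_def E'_def)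
      have vC: "v \<notin> C" using del(1) assms(3) by auto
      have E_eq: "E = E' \<union> (\<lambda>u. {v, u}) ` C" using star[OF F] by (simp add: C_def E'_def)
      have v': "\<And>e. e \<in> E' \<Longrightarrow> v \<notin> e" by (simp add: E'_def)
      note ds = ug_degree_star[OF finE[OF del(2)] v' vC, folded E_eq]
      have "C \<in> I" using del(1) ds(1) deg[OF vV] by (simp add: I_def)
      moreover have "E' \<in> G C"
        unfolding G_def bounded_forests_def
      proof (intro CollectI conjI ballI del(2))
        fix u assume u: "u \<in> V - {v}"
        then show "ug_degree E' u \<le> b' C u"
          using ds(2)[of u] deg[of u] by (auto simp: b'_def split: if_splits)
      qed
      ultimately show "x \<in> (SIGMA C:I. G C)" by (simp add: x)
    qed
  qed
  then have "card (bounded_forests b V R) = card (SIGMA C:I. G C)"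
    by (simp add: bij_betw_same_card)
  also have "\<dots> = (\<Sum>C\<in>I. card (G C))"
    using finI assms(1) by (intro card_SigmaI) (auto simp: G_def intro: finite_bounded_forests)
  finally show ?thesis
    by (simp add: I_def G_def b'_def[abs_def])
qed

lemma sum_over_subsets_card:
  fixes g :: "nat \<Rightarrow> real"
  assumes "finite A"
  shows "(\<Sum>C | C \<subseteq> A \<and> card C \<le> k. g (card C)) =
    (\<Sum>c\<le>card A. if c \<le> k then real (card A choose c) * g c else 0)"
proof -
  have "(\<Sum>C | C \<subseteq> A \<and> card C \<le> k. g (card C)) =
      (\<Sum>C\<in>Pow A. if card C \<le> k then g (card C) else 0)"
    using assms by (intro sum.mono_neutral_cong_left) auto
  also have "\<dots> = (\<Sum>c\<le>card A. \<Sum>C | C \<in> Pow A \<and> card C = c. if card C \<le> k then g (card C) else 0)"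
    using assms by (intro sum.group[symmetric]) (auto intro: card_mono)
  also have "\<dots> = (\<Sum>c\<le>card A. if c \<le> k then real (card A choose c) * g c else 0)"
    using assms by (intro sum.cong) (auto simp: n_subsets Pow_def)
  finally show ?thesis .
qed

lemma coeff_gamma_poly: "coeff (gamma_poly \<Delta>) k = (if k < \<Delta> then 1 / fact k else 0)"
  by (simp add: gamma_poly_def coeff_sum)

section \<open>Solving the recursion by coefficients of powers\<close>

text \<open>The factor \<open>c\<close> turns \<open>p\<close> into \<open>x p'\<close>, and
  \<open>(k + 1) x p' p^k\<close> is \<open>x\<close> times the derivative of
  \<open>p^(k + 1)\<close>; the part with the constant factor \<open>a\<close> is a plain
  convolution.\<close>

lemma sum_weighted_coeff_power_Suc:
  fixes p :: "real poly"
  shows "real (Suc k) * (\<Sum>c\<le>u. (a + real c) * coeff p c * coeff (p ^ k) (u - c)) =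
    (real (Suc k) * a + real u) * coeff (p ^ Suc k) u"
proof -
  have x_pderiv: "coeff (pCons 0 (pderiv q)) j = real j * coeff q j" for q :: "real poly" and j
    by (cases j) (simp_all add: coeff_pderiv)
  have "(\<Sum>c\<le>u. (a + real c) * coeff p c * coeff (p ^ k) (u - c)) =
      a * coeff (p ^ Suc k) u + coeff (pCons 0 (pderiv p) * p ^ k) u"
    unfolding power_Suc coeff_mult x_pderiv
    by (simp add: algebra_simps sum.distrib sum_distrib_left)
  moreover have "real (Suc k) * coeff (pCons 0 (pderiv p) * p ^ k) u = real u * coeff (p ^ Suc k) u"
  proof -
    have eq: "pCons 0 (pderiv (p ^ Suc k)) = smult (real (Suc k)) (pCons 0 (pderiv p) * p ^ k)"
      by (simp add: pderiv_power_Suc mult.commute del: power_Suc of_nat_Suc)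
    show ?thesis
      unfolding x_pderiv[symmetric] eq by (rule coeff_smult[symmetric])
  qed
  ultimately show ?thesis by (simp only: distrib_left) (simp add: algebra_simps)
qed

text \<open>This is Lagrange inversion for the tree equation \<open>T = x \<gamma>(T)\<close>,
  proved by induction on the number of vertices: deleting a root gives a convolution, which
  \<open>sum_weighted_coeff_power_Suc\<close> evaluates.\<close>

lemma card_bounded_forests:
  assumes "\<Delta> \<ge> 1" "finite V" "V \<noteq> {}" "R \<subseteq> V"
  shows "real (card V) * real (card (bounded_forests (\<lambda>u. if u \<in> R then \<Delta> - 1 else \<Delta>) V R)) =
    real (card R) * fact (card V - card R) * coeff (gamma_poly \<Delta> ^ card V) (card V - card R)"
  using assms(2-4)
proof (induction "card V" arbitrary: V R)
  case 0
  then show ?case by simp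
next
  case (Suc N V R)
  let ?bf = "\<lambda>R V. bounded_forests (\<lambda>u. if u \<in> R then \<Delta> - 1 else \<Delta>) V R"
  let ?g = "gamma_poly \<Delta>"
  show ?case
  proof (cases "R = {}")
    case True
    then have "?bf R V = {}"
      using Suc.prems by (auto simp: bounded_forests_def forest_rooted_at_def)
    then show ?thesis using True by simp
  next
    case False
    then obtain v where v: "v \<in> R" by auto
    then have vV: "v \<in> V" using Suc.prems by auto
    define m where "m = card R"
    define u where "u = card V - m"
    have finR: "finite R" using Suc.prems finite_subset by blast
    have m: "m \<ge> 1" "m \<le> card V"
      using v finR Suc.prems by (auto simp: m_def Suc_le_eq card_gt_0_iff card_mono)
    have cVR: "card (V - R) = u"
      using Suc.prems finR by (simp add: u_def m_def card_Diff_subset)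
    have cVv: "card (V - {v}) = N" using Suc.hyps(2) vV by simp
    have step: "real (card (?bf R V)) =
        (\<Sum>C | C \<subseteq> V - R \<and> card C \<le> \<Delta> - 1. real (card (?bf (R - {v} \<union> C) (V - {v}))))"
    proof -
      have "card (?bf R V) = (\<Sum>C | C \<subseteq> V - R \<and> card C \<le> \<Delta> - 1. card (?bf (R - {v} \<union> C) (V - {v})))"
      proof (rule trans[OF card_bounded_forests_delete_root[OF Suc.prems(1,3) v]])
        show "1 \<le> (if u \<in> R then \<Delta> - 1 else \<Delta>)" if "u \<in> V - R" for u
          using that assms(1) by simp
        show "(\<Sum>C | C \<subseteq> V - R \<and> card C \<le> (if v \<in> R then \<Delta> - 1 else \<Delta>).
            card (bounded_forests (\<lambda>u. if u \<in> C then (if u \<in> R then \<Delta> - 1 else \<Delta>) - 1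
              else if u \<in> R then \<Delta> - 1 else \<Delta>) (V - {v}) (R - {v} \<union> C))) =
            (\<Sum>C | C \<subseteq> V - R \<and> card C \<le> \<Delta> - 1. card (?bf (R - {v} \<union> C) (V - {v})))"
        \<comment> \<open>A member of \<open>C\<close> was a nonroot with bound
          \<open>\<Delta>\<close>; after losing its edge to \<open>v\<close> it has bound
          \<open>\<Delta> - 1\<close>, exactly that of the root it becomes. Hence the smaller count
          is of the same form.\<close>
        proof (intro sum.cong arg_cong[of _ _ card] bounded_forests_cong)
          fix C u assume "C \<in> {C. C \<subseteq> V - R \<and> card C \<le> \<Delta> - 1}" "u \<in> V - {v}"
          then have "u \<in> C \<Longrightarrow> u \<notin> R" "u \<noteq> v" by blast+
          then show "(if u \<in> C then (if u \<in> R then \<Delta> - 1 else \<Delta>) - 1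
              else if u \<in> R then \<Delta> - 1 else \<Delta>) = (if u \<in> R - {v} \<union> C then \<Delta> - 1 else \<Delta>)"
            by auto
        qed (use v in simp)
      qed
      then show ?thesis by simp
    qed
    show ?thesis
    \<comment> \<open>A single vertex is treated separately: the induction hypothesis needs a
      nonempty rest, and the factor \<open>N\<close> is cancelled at the end.\<close>
    proof (cases "N = 0")
      case True
      then have V: "V = {v}" using Suc.hyps(2) vV by (metis card_1_singletonE One_nat_def singletonD)
      then have R: "R = {v}" using v Suc.prems by auto
      have "\<not> ug_cycle {} vs" for vs :: "'a list"
        unfolding ug_cycle_def by (metis empty_iff less_le_trans zero_less_numeral)
      then have "bounded_forests b {} {} = {{}}" for b :: "'a \<Rightarrow> nat"
        by (auto simp: bounded_forests_def forest_rooted_at_def ugraph_def)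
      moreover have "{C. C \<subseteq> {} \<and> card C \<le> \<Delta> - 1} = {{} :: 'a set}" by auto
      ultimately have "real (card (?bf R V)) = 1"
        using step by (simp add: V R)
      then show ?thesis using assms(1) by (simp add: V R coeff_gamma_poly)
    next
      case False
      have cC: "card (R - {v} \<union> C) = m - 1 + card C" "card C \<le> u" if "C \<subseteq> V - R" for C
      proof -
        have "finite C" using that Suc.prems finite_subset by blast
        then show "card (R - {v} \<union> C) = m - 1 + card C"
          using that finR v by (subst card_Un_disjoint) (auto simp: m_def)
        show "card C \<le> u" using that Suc.prems cVR card_mono by (metis finite_Diff)
      qed
      \<comment> \<open>By the induction hypothesis, \<open>N\<close> times the number of forests
        left after deleting \<open>v\<close> depends on \<open>C\<close> only through
        \<open>c = card C\<close>: there are \<open>m - 1 + c\<close> roots and \<open>u - c\<close>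
        other vertices.\<close>
      define h where "h c = (real (m - 1) + real c) * fact (u - c) * coeff (?g ^ N) (u - c)" for c
      have IH: "real N * real (card (?bf (R - {v} \<union> C) (V - {v}))) = h (card C)"
        if C: "C \<subseteq> V - R" for C
      proof -
        have "V - {v} \<noteq> {}" using cVv False by (metis card.empty)
        moreover have "R - {v} \<union> C \<subseteq> V - {v}" using C v Suc.prems by auto
        ultimately have "real N * real (card (?bf (R - {v} \<union> C) (V - {v}))) =
            real (m - 1 + card C) * fact (N - (m - 1 + card C)) * coeff (?g ^ N) (N - (m - 1 + card C))"
          using Suc.hyps(1)[of "V - {v}" "R - {v} \<union> C"] Suc.prems cVv cC(1)[OF C] by simp
        moreover have "N - (m - 1 + card C) = u - card C"
          using m Suc.hyps(2) by (simp add: u_def)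
        ultimately show ?thesis by (simp add: h_def)
      qed
      have "real N * real (card (?bf R V)) = (\<Sum>C | C \<subseteq> V - R \<and> card C \<le> \<Delta> - 1. h (card C))"
        unfolding step sum_distrib_left by (intro sum.cong IH) auto
      also have "\<dots> = (\<Sum>c\<le>u. if c \<le> \<Delta> - 1 then real (u choose c) * h c else 0)"
        using sum_over_subsets_card[of "V - R" h "\<Delta> - 1"] Suc.prems(1) unfolding cVR by simp
      also have "\<dots> = (\<Sum>c\<le>u. fact u * ((real (m - 1) + real c) * coeff ?g c * coeff (?g ^ N) (u - c)))"
      proof (intro sum.cong refl)
        fix c assume "c \<in> {..u}"
        then have bin: "real (u choose c) * fact (u - c) = fact u / fact c"
          by (simp add: binomial_fact)
        have "real (u choose c) * h c =
            real (u choose c) * fact (u - c) * ((real (m - 1) + real c) * coeff (?g ^ N) (u - c))"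
          by (simp only: h_def mult_ac)
        then show "(if c \<le> \<Delta> - 1 then real (u choose c) * h c else 0) =
            fact u * ((real (m - 1) + real c) * coeff ?g c * coeff (?g ^ N) (u - c))"
          unfolding bin using assms(1) by (auto simp: coeff_gamma_poly)
      qed
      also have "\<dots> = fact u * (\<Sum>c\<le>u. (real (m - 1) + real c) * coeff ?g c * coeff (?g ^ N) (u - c))"
        by (simp only: sum_distrib_left)
      finally have "real (Suc N) * (real N * real (card (?bf R V))) =
          fact u * ((real (Suc N) * real (m - 1) + real u) * coeff (?g ^ Suc N) u)"
        using sum_weighted_coeff_power_Suc[of N "real (m - 1)" ?g u] by (simp only: mult_ac)
      \<comment> \<open>Since \<open>u = N + 1 - m\<close>, the weight is a multiple of
        \<open>N\<close>; this is what makes the formula reproduce itself.\<close>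
      also have "real (Suc N) * real (m - 1) + real u = real N * real m"
      proof -
        have "real u = real (Suc N) - real m" using m Suc.hyps(2) by (simp add: u_def of_nat_diff)
        moreover have "real (m - 1) = real m - 1" using m by (simp add: of_nat_diff)
        ultimately show ?thesis by (simp add: algebra_simps)
      qed
      finally have "real N * (real (Suc N) * real (card (?bf R V))) =
          real N * (real m * fact u * coeff (?g ^ Suc N) u)"
        by (simp only: mult_ac)
      then have "real (Suc N) * real (card (?bf R V)) = real m * fact u * coeff (?g ^ Suc N) u"
        using False by (simp only: mult_cancel_left of_nat_eq_0_iff) simp
      then show ?thesis
        using Suc.hyps(2) by (simp add: u_def m_def)
    qed
  qed
qed

section \<open>Closed forms for the two counts\<close>

text \<open>The count for a given root set depends only on its size, so it is multiplied by
  \<open>n choose m\<close>; the factorials then simplify after division by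
  \<open>n\<close>.\<close>

lemma forest_count_eq:
  assumes "\<Delta> \<ge> 1" "1 \<le> m" "m \<le> n"
  shows "real (forest_count \<Delta> n m) = fact (n - 1) / fact (m - 1) * coeff (gamma_poly \<Delta> ^ n) (n - m)"
proof -
  let ?V = "{1..n}" and ?g = "gamma_poly \<Delta>"
  let ?bf = "\<lambda>R. bounded_forests (\<lambda>u. if u \<in> R then \<Delta> - 1 else \<Delta>) ?V R"
  have "(\<forall>v\<in>?V. ug_degree E v \<le> \<Delta>) \<and> (\<forall>v\<in>R. ug_degree E v \<le> \<Delta> - 1) \<longleftrightarrow>
      (\<forall>v\<in>?V. ug_degree E v \<le> (if v \<in> R then \<Delta> - 1 else \<Delta>))" if "R \<subseteq> ?V" for E and R :: "nat set"
    using that by (auto split: if_splits dest: bspec intro: order_trans[OF _ diff_le_self])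
  moreover have "R \<subseteq> ?V" if "forest_rooted_at ?V E R" for E R
    using that by (simp add: forest_rooted_at_def)
  ultimately have "{(E, R). rooted_forest ?V E R \<and> (\<forall>v\<in>?V. ug_degree E v \<le> \<Delta>) \<and>
        card (ug_components ?V E) = m \<and> (\<forall>v\<in>R. ug_degree E v \<le> \<Delta> - 1)} =
      (\<lambda>(R, E). (E, R)) ` (SIGMA R:{R. R \<subseteq> ?V \<and> card R = m}. ?bf R)"
    unfolding rooted_forest_iff bounded_forests_def
    by (safe; (simp add: card_ug_components image_iff; fail)?) blast+
  then have "forest_count \<Delta> n m = card (SIGMA R:{R. R \<subseteq> ?V \<and> card R = m}. ?bf R)"
    unfolding forest_count_def by (simp add: card_image inj_on_def split_def prod_eq_iff)
  also have "\<dots> = (\<Sum>R | R \<subseteq> ?V \<and> card R = m. card (?bf R))"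
    by (intro card_SigmaI) (auto intro: finite_bounded_forests)
  finally have "real n * real (forest_count \<Delta> n m) = (\<Sum>R | R \<subseteq> ?V \<and> card R = m. real n * real (card (?bf R)))"
    by (simp add: sum_distrib_left)
  also have "\<dots> = (\<Sum>R | R \<subseteq> ?V \<and> card R = m. real m * fact (n - m) * coeff (?g ^ n) (n - m))"
    using card_bounded_forests[OF assms(1), of ?V] assms by (intro sum.cong) auto
  also have "\<dots> = real (n choose m) * (real m * fact (n - m) * coeff (?g ^ n) (n - m))"
    using n_subsets[of ?V m] by simp
  also have "\<dots> = real n * (fact (n - 1) / fact (m - 1) * coeff (?g ^ n) (n - m))"
  proof -
    have "fact n = real n * fact (n - 1)" "fact m = real m * fact (m - 1)"
      using assms by (simp_all add: fact_reduce)
    then show ?thesis using assms by (simp add: binomial_fact field_simps)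
  qed
  finally show ?thesis
    using assms by (simp only: mult_cancel_left of_nat_eq_0_iff) auto
qed

text \<open>A tree is rooted at the vertex 1, but this root may have degree \<open>\<Delta>\<close>
  and not only \<open>\<Delta> - 1\<close>, so \<open>card_bounded_forests\<close> does not apply to
  it directly. It is deleted first, and the formula is applied to the forest on the other
  \<open>n - 1\<close> vertices, rooted at its neighbours.\<close>

lemma tree_count_eq:
  assumes "\<Delta> \<ge> 1" "n \<ge> 2"
  shows "real (tree_count \<Delta> n) = fact (n - 2) * coeff (gamma_poly \<Delta> ^ n) (n - 2)"
proof -
  let ?V = "{1..n}" and ?g = "gamma_poly \<Delta>"
  let ?bf = "\<lambda>C. bounded_forests (\<lambda>u. if u \<in> C then \<Delta> - 1 else \<Delta>) (?V - {1}) C"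
  have cV: "card (?V - {1}) = n - 1" using assms by simp
  have "tree_count \<Delta> n = card (bounded_forests (\<lambda>_. \<Delta>) ?V {1})"
    unfolding tree_count_def bounded_forests_def using ug_tree_iff[of 1 ?V] assms by simp
  also have "\<dots> = (\<Sum>C | C \<subseteq> ?V - {1} \<and> card C \<le> \<Delta>. card (?bf C))"
    using assms by (subst card_bounded_forests_delete_root[of _ _ 1]) auto
  finally have "real (n - 1) * real (tree_count \<Delta> n) =
      (\<Sum>C | C \<subseteq> ?V - {1} \<and> card C \<le> \<Delta>. real (n - 1) * real (card (?bf C)))"
    by (simp add: sum_distrib_left)
  also have "\<dots> = (\<Sum>C | C \<subseteq> ?V - {1} \<and> card C \<le> \<Delta>.
      real (card C) * fact (n - 1 - card C) * coeff (?g ^ (n - 1)) (n - 1 - card C))"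
  proof (intro sum.cong refl)
    fix C assume C: "C \<in> {C. C \<subseteq> ?V - {1} \<and> card C \<le> \<Delta>}"
    have "?V - {1} \<noteq> {}" using cV assms by (metis card.empty diff_is_0_eq not_less_eq_eq numeral_2_eq_2 One_nat_def)
    then show "real (n - 1) * real (card (?bf C)) =
        real (card C) * fact (n - 1 - card C) * coeff (?g ^ (n - 1)) (n - 1 - card C)"
      using card_bounded_forests[OF assms(1), of "?V - {1}" C] C cV by simp
  qed
  also have "\<dots> = (\<Sum>c\<le>n - 1. if c \<le> \<Delta> then real (n - 1 choose c) *
      (real c * fact (n - 1 - c) * coeff (?g ^ (n - 1)) (n - 1 - c)) else 0)"
    using sum_over_subsets_card[of "?V - {1}" "\<lambda>c. real c * fact (n - 1 - c) * coeff (?g ^ (n - 1)) (n - 1 - c)" \<Delta>]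
    unfolding cV by simp
  \<comment> \<open>The factor \<open>c\<close> kills the term \<open>c = 0\<close> and reduces
    \<open>1 / c!\<close> to \<open>1 / j!\<close> with \<open>c = j + 1\<close>. The bound
    \<open>c \<le> \<Delta>\<close> becomes \<open>j < \<Delta>\<close>, so a further factor
    \<open>?g\<close> appears in the convolution.\<close>
  also have "\<dots> = (\<Sum>c\<le>Suc (n - 2). case c of 0 \<Rightarrow> 0 | Suc j \<Rightarrow>
      fact (n - 1) * (coeff ?g j * coeff (?g ^ (n - 1)) (n - 2 - j)))"
  proof (intro sum.cong)
    show "{..n - 1} = {..Suc (n - 2)}" using assms by simp
    fix c assume c: "c \<in> {..Suc (n - 2)}"
    show "(if c \<le> \<Delta> then real (n - 1 choose c) *
      (real c * fact (n - 1 - c) * coeff (?g ^ (n - 1)) (n - 1 - c)) else 0) = (case c of 0 \<Rightarrow> 0 | Suc j \<Rightarrow>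
      fact (n - 1) * (coeff ?g j * coeff (?g ^ (n - 1)) (n - 2 - j)))"
    proof (cases c)
      case (Suc j)
      have "c \<le> n - 1" using c assms by simp
      then have "real (n - 1 choose c) * fact (n - 1 - c) = fact (n - 1) / fact c"
        by (simp add: binomial_fact)
      then have "real (n - 1 choose c) * (real c * fact (n - 1 - c)) = fact (n - 1) * (real c / fact c)"
        by (simp add: mult_ac)
      also have "real c / fact c = 1 / fact j"
        by (simp add: Suc)
      finally have "real (n - 1 choose c) * (real c * fact (n - 1 - c)) = fact (n - 1) / fact j" by simp
      moreover have "n - 1 - c = n - 2 - j" using Suc by simp
      ultimately show ?thesis
        using Suc by (auto simp: coeff_gamma_poly mult.assoc[symmetric])
    qed simp
  qed
  also have "\<dots> = fact (n - 1) * coeff (?g * ?g ^ (n - 1)) (n - 2)"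
    by (simp add: sum.atMost_Suc_shift coeff_mult sum_distrib_left del: sum.atMost_Suc)
  also have "?g * ?g ^ (n - 1) = ?g ^ n"
    using assms by (metis One_nat_def Suc_pred less_le_trans pos2 power_Suc)
  also have "fact (n - 1) = real (n - 1) * (fact (n - 2) :: real)"
  proof -
    obtain k where "n = Suc (Suc k)"
      using assms(2) by (metis add_2_eq_Suc le_Suc_ex)
    then show ?thesis by simp
  qed
  finally show ?thesis using assms by simp
qed

section \<open>Local limit theorem\<close>

lemma gaussian_integral:
  fixes \<beta> :: real
  assumes "\<beta> > 0"
  shows "integrable lborel (\<lambda>t. exp (- (\<beta> * t\<^sup>2 / 2)))"
    and "(\<integral>t. exp (- (\<beta> * t\<^sup>2 / 2)) \<partial>lborel) = sqrt (2 * pi / \<beta>)"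
proof -
  define \<sigma> where "\<sigma> = 1 / sqrt \<beta>"
  have \<sigma>: "\<sigma> > 0" "\<sigma>\<^sup>2 = 1 / \<beta>"
    using assms by (simp_all add: \<sigma>_def power_divide)
  have eq: "(\<lambda>t. exp (- (\<beta> * t\<^sup>2 / 2))) = (\<lambda>t. sqrt (2 * pi / \<beta>) * normal_density 0 \<sigma> t)"
    using assms by (auto simp: normal_density_def \<sigma>(2) fun_eq_iff field_simps)
  show "integrable lborel (\<lambda>t. exp (- (\<beta> * t\<^sup>2 / 2)))"
    unfolding eq using \<sigma>(1) by (intro integrable_mult_right integrable_normal_density)
  show "(\<integral>t. exp (- (\<beta> * t\<^sup>2 / 2)) \<partial>lborel) = sqrt (2 * pi / \<beta>)"
    unfolding eq using integral_normal_density[OF \<sigma>(1)] by simp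
qed

text \<open>After the substitution of \<open>t / sqrt n\<close> the \<open>n\<close>-th power
  approaches a Gaussian pointwise, and the decay hypothesis supplies an integrable majorant. The
  variances \<open>\<beta> n\<close> need not converge, so the statement concerns a difference. The
  factor with the fixed \<open>j\<close> tends to 1 under the rescaling.\<close>

lemma local_limit:
  fixes \<psi> :: "nat \<Rightarrow> real \<Rightarrow> complex" and \<beta> :: "nat \<Rightarrow> real" and I :: "nat \<Rightarrow> complex"
  assumes "c > 0" "\<beta>0 > 0" "n0 \<ge> 1"
    and \<beta>: "\<And>n. n \<ge> n0 \<Longrightarrow> \<beta> n \<ge> \<beta>0"
    and cont: "\<And>n. n \<ge> n0 \<Longrightarrow> continuous_on UNIV (\<psi> n)"
    and decay: "\<And>n \<theta>. n \<ge> n0 \<Longrightarrow> \<bar>\<theta>\<bar> \<le> pi \<Longrightarrow> cmod (\<psi> n \<theta>) \<le> exp (- (c * \<theta>\<^sup>2))"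
    and approx: "\<And>n \<theta>. n \<ge> n0 \<Longrightarrow> \<bar>\<theta>\<bar> \<le> 1 \<Longrightarrow>
      cmod (\<psi> n \<theta> - of_real (exp (- (\<beta> n * \<theta>\<^sup>2 / 2)))) \<le> K * \<bar>\<theta>\<bar> ^ 3"
    and I: "\<And>n. n \<ge> n0 \<Longrightarrow> ((\<lambda>t. \<psi> n t ^ n * cis (real j * t)) has_integral I n) {-pi..pi}"
  shows "(\<lambda>n. of_real (sqrt n) * I n - of_real (sqrt (2 * pi / \<beta> n))) \<longlonglongrightarrow> 0"
proof -
  define \<Phi> where "\<Phi> n t = \<psi> n t ^ n * cis (real j * t)" for n t
  define f where "f n t = indicator {-pi..pi} t *\<^sub>R \<Phi> n t" for n and t :: real
  define h where "h n t = f n (t / sqrt n)" for n and t :: real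
  define G where "G n t = exp (- (\<beta> n * t\<^sup>2 / 2))" for n and t :: real
  have cont\<Phi>: "continuous_on A (\<Phi> n)" if "n \<ge> n0" for n A
    unfolding \<Phi>_def by (intro continuous_intros continuous_on_subset[OF cont[OF that]]) auto
  have f_int: "integrable lborel (f n)" if "n \<ge> n0" for n
    using borel_integrable_compact[OF compact_Icc cont\<Phi>[OF that, of "{-pi..pi}"]]
    by (simp add: f_def[abs_def])
  have f_I: "(\<integral>t. f n t \<partial>lborel) = I n" if "n \<ge> n0" for n
  proof -
    have "(LINT t : {-pi..pi} | lborel. \<Phi> n t) = integral {-pi..pi} (\<Phi> n)"
      by (rule set_borel_integral_eq_integral)
         (use f_int[OF that] in \<open>simp add: set_integrable_def f_def[abs_def]\<close>)
    also have "\<dots> = I n"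
      using I[OF that] by (simp add: \<Phi>_def[abs_def] integral_unique)
    finally show ?thesis by (simp add: set_lebesgue_integral_def f_def)
  qed
  have h_int: "integrable lborel (h n)" "(\<integral>t. h n t \<partial>lborel) = of_real (sqrt n) * I n" if "n \<ge> n0" for n
  proof -
    have n: "n > 0" using that assms(3) by simp
    have h_eq: "h n = (\<lambda>t. f n (0 + (1 / sqrt n) * t))" by (simp add: h_def fun_eq_iff)
    show "integrable lborel (h n)"
      unfolding h_eq using n by (intro lborel_integrable_real_affine f_int that) simp
    have "I n = \<bar>1 / sqrt n\<bar> *\<^sub>R (\<integral>t. h n t \<partial>lborel)"
      unfolding f_I[OF that, symmetric] h_eq using n by (intro lborel_integral_real_affine) simp
    then show "(\<integral>t. h n t \<partial>lborel) = of_real (sqrt n) * I n"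
      using n by (simp add: scaleR_conv_of_real)
  qed
  have h_bound: "cmod (h n t) \<le> exp (- (2 * c * t\<^sup>2 / 2))" if "n \<ge> n0" for n t
  proof (cases "\<bar>t / sqrt n\<bar> \<le> pi")
    case True
    have n: "n > 0" using that assms(3) by simp
    have "t / sqrt n \<in> {-pi..pi}" using True unfolding abs_le_iff by auto
    then have "cmod (h n t) = cmod (\<psi> n (t / sqrt n)) ^ n"
      by (simp add: h_def f_def \<Phi>_def norm_mult norm_power)
    also have "\<dots> \<le> exp (- (c * (t / sqrt n)\<^sup>2)) ^ n"
      by (intro power_mono decay that True) auto
    also have "\<dots> = exp (- (c * t\<^sup>2))"
      using n by (simp add: exp_of_nat_mult[symmetric] power_divide)
    finally show ?thesis by simp
  next
    case False
    then have "t / sqrt n \<notin> {-pi..pi}" by auto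
    then show ?thesis by (simp add: h_def f_def)
  qed
  have \<beta>pos: "\<beta> n > 0" if "n \<ge> n0" for n
    using \<beta>[OF that] assms(2) by simp
  have G_int: "integrable lborel (G n)" "(\<integral>t. G n t \<partial>lborel) = sqrt (2 * pi / \<beta> n)" if "n \<ge> n0" for n
    using gaussian_integral[OF \<beta>pos[OF that]] by (simp_all add: G_def[abs_def])
  have pointwise: "(\<lambda>n. h n t - of_real (G n t)) \<longlonglongrightarrow> 0" for t
  proof -
    \<comment> \<open>The first term bounds the effect of the factor with \<open>j\<close>; the
      second is \<open>n\<close> times the cubic error at \<open>t / sqrt n\<close>.\<close>
    define b where "b n = \<bar>real j * (t / sqrt n)\<bar> + K * \<bar>t\<bar> ^ 3 / sqrt n" for n :: nat
    have "b \<longlonglongrightarrow> \<bar>real j * 0\<bar> + 0"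
      unfolding b_def
      by (intro tendsto_intros tendsto_divide_0[OF tendsto_const]
          filterlim_at_top_imp_at_infinity filterlim_compose[OF sqrt_at_top filterlim_real_sequentially])
    then have b0: "b \<longlonglongrightarrow> 0" by simp
    \<comment> \<open>From \<open>n \<ge> t^2\<close> on, the rescaled argument lies in the range
      where the cubic approximation is assumed.\<close>
    have "eventually (\<lambda>n. n \<ge> max n0 (nat \<lceil>t\<^sup>2\<rceil>)) sequentially"
      by (rule eventually_ge_at_top)
    then have "eventually (\<lambda>n. cmod (h n t - of_real (G n t)) \<le> b n) sequentially"
    proof eventually_elim
      case (elim n)
      then have n: "n \<ge> n0" "n > 0" "t\<^sup>2 \<le> real n" using assms(3) by linarith+
      define \<theta> where "\<theta> = t / sqrt n"
      have \<theta>1: "\<bar>\<theta>\<bar> \<le> 1"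
        using n real_sqrt_le_mono[OF n(3)] by (simp add: \<theta>_def)
      then have \<theta>pi: "\<bar>\<theta>\<bar> \<le> pi" using pi_gt3 by linarith
      define g where "g = complex_of_real (exp (- (\<beta> n * \<theta>\<^sup>2 / 2)))"
      have Gg: "of_real (G n t) = g ^ n"
      proof -
        have "exp (- (\<beta> n * \<theta>\<^sup>2 / 2)) ^ n = G n t"
          using n by (simp add: G_def exp_of_nat_mult[symmetric] power_divide \<theta>_def)
        then show ?thesis by (simp add: g_def flip: of_real_power)
      qed
      have g1: "cmod g \<le> 1" using \<beta>pos[OF n(1)] by (simp add: g_def)
      have \<psi>1: "cmod (\<psi> n \<theta>) \<le> 1"
        by (rule order_trans[OF decay[OF n(1) \<theta>pi]]) (use assms(1) in simp)
      have hh: "h n t = \<psi> n \<theta> ^ n * cis (real j * \<theta>)"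
        using \<theta>pi by (simp add: h_def f_def \<Phi>_def \<theta>_def[symmetric] indicator_def abs_le_iff)
      have "cmod (cis (real j * \<theta>) - 1) \<le> \<bar>real j * \<theta>\<bar>"
        using iexp_approx1[of "real j * \<theta>" 0] by (simp add: cis_conv_exp)
      then have 1: "cmod (\<psi> n \<theta> ^ n * (cis (real j * \<theta>) - 1)) \<le> 1 * \<bar>real j * \<theta>\<bar>"
        unfolding norm_mult norm_power using \<psi>1 by (intro mult_mono power_le_one) auto
      \<comment> \<open>Both bases have norm at most 1, so passing to \<open>n\<close>-th powers
        costs only a factor \<open>n\<close>.\<close>
      have "cmod (\<psi> n \<theta> ^ n - g ^ n) \<le> real n * cmod (\<psi> n \<theta> - g)"
        using norm_power_diff[OF \<psi>1 g1, of n] by simp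
      also have "\<dots> \<le> real n * (K * \<bar>\<theta>\<bar> ^ 3)"
        using approx[OF n(1) \<theta>1] by (intro mult_left_mono) (auto simp: g_def)
      also have "\<dots> = K * \<bar>t\<bar> ^ 3 / sqrt n"
      proof -
        have "sqrt n ^ 3 = real n * sqrt n" by (simp add: power3_eq_cube)
        then show ?thesis using n by (simp add: \<theta>_def power_divide)
      qed
      finally have 2: "cmod (\<psi> n \<theta> ^ n - g ^ n) \<le> K * \<bar>t\<bar> ^ 3 / sqrt n" .
      have "h n t - of_real (G n t) = \<psi> n \<theta> ^ n * (cis (real j * \<theta>) - 1) + (\<psi> n \<theta> ^ n - g ^ n)"
        by (simp add: hh Gg algebra_simps)
      then show "cmod (h n t - of_real (G n t)) \<le> b n"
        using norm_triangle_ineq[of "\<psi> n \<theta> ^ n * (cis (real j * \<theta>) - 1)" "\<psi> n \<theta> ^ n - g ^ n"] 1 2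
        by (simp add: b_def \<theta>_def)
    qed
    then show ?thesis using b0 by (rule Lim_null_comparison)
  qed
  \<comment> \<open>The index is shifted because dominated convergence asks for its bounds at every
    index, while the hypotheses hold only from \<open>n0\<close> on.\<close>
  have "(\<lambda>n. \<integral>t. h (n + n0) t - of_real (G (n + n0) t) \<partial>lborel) \<longlonglongrightarrow> (\<integral>(t::real). 0 \<partial>lborel)"
  proof (rule integral_dominated_convergence)
    show "integrable lborel (\<lambda>t. exp (- (2 * c * t\<^sup>2 / 2)) + exp (- (\<beta>0 * t\<^sup>2 / 2)))"
      using assms(1,2) by (intro Bochner_Integration.integrable_add gaussian_integral) auto
    show "AE t in lborel. (\<lambda>n. h (n + n0) t - of_real (G (n + n0) t)) \<longlonglongrightarrow> 0"
      using pointwise by (intro AE_I2 LIMSEQ_ignore_initial_segment)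
    fix n
    show "(\<lambda>t. h (n + n0) t - of_real (G (n + n0) t)) \<in> borel_measurable lborel"
      using h_int(1)[of "n + n0"] G_int(1)[of "n + n0"] by simp
    show "AE t in lborel. cmod (h (n + n0) t - of_real (G (n + n0) t))
        \<le> exp (- (2 * c * t\<^sup>2 / 2)) + exp (- (\<beta>0 * t\<^sup>2 / 2))"
    proof (rule AE_I2)
      fix t
      have "G (n + n0) t \<le> exp (- (\<beta>0 * t\<^sup>2 / 2))"
        using \<beta>[of "n + n0"] by (simp add: G_def mult_right_mono)
      moreover have "cmod (of_real (G (n + n0) t)) = G (n + n0) t" by (simp add: G_def)
      ultimately show "cmod (h (n + n0) t - of_real (G (n + n0) t))
        \<le> exp (- (2 * c * t\<^sup>2 / 2)) + exp (- (\<beta>0 * t\<^sup>2 / 2))"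
        using norm_triangle_ineq4[of "h (n + n0) t" "of_real (G (n + n0) t)"] h_bound[of "n + n0" t]
        by linarith
    qed
  qed simp
  moreover have "(\<integral>t. h (n + n0) t - of_real (G (n + n0) t) \<partial>lborel) =
      of_real (sqrt (n + n0)) * I (n + n0) - of_real (sqrt (2 * pi / \<beta> (n + n0)))" for n
    using h_int[of "n + n0"] G_int[of "n + n0"] by (simp add: integrable_of_real)
  ultimately have "(\<lambda>n. of_real (sqrt (n + n0)) * I (n + n0) - of_real (sqrt (2 * pi / \<beta> (n + n0)))) \<longlonglongrightarrow> 0"
    by simp
  then show ?thesis by (rule LIMSEQ_offset)
qed

text \<open>The upper bound \<open>B\<close> on the variances keeps the Gaussian main term away from
  zero, so the vanishing absolute error is also a vanishing relative error.\<close>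

lemma local_limit_asymp_equiv:
  fixes \<psi> :: "nat \<Rightarrow> real \<Rightarrow> complex" and \<beta> x :: "nat \<Rightarrow> real"
  assumes "c > 0" "\<beta>0 > 0" "n0 \<ge> 1"
    and \<beta>: "\<And>n. n \<ge> n0 \<Longrightarrow> \<beta> n \<ge> \<beta>0" "\<And>n. n \<ge> n0 \<Longrightarrow> \<beta> n \<le> B"
    and "\<And>n. n \<ge> n0 \<Longrightarrow> continuous_on UNIV (\<psi> n)"
    and "\<And>n \<theta>. n \<ge> n0 \<Longrightarrow> \<bar>\<theta>\<bar> \<le> pi \<Longrightarrow> cmod (\<psi> n \<theta>) \<le> exp (- (c * \<theta>\<^sup>2))"
    and "\<And>n \<theta>. n \<ge> n0 \<Longrightarrow> \<bar>\<theta>\<bar> \<le> 1 \<Longrightarrow>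
      cmod (\<psi> n \<theta> - of_real (exp (- (\<beta> n * \<theta>\<^sup>2 / 2)))) \<le> K * \<bar>\<theta>\<bar> ^ 3"
    and "\<And>n. n \<ge> n0 \<Longrightarrow>
      ((\<lambda>t. \<psi> n t ^ n * cis (real j * t)) has_integral of_real (2 * pi * x n)) {-pi..pi}"
  shows "x \<sim>[sequentially] (\<lambda>n. 1 / sqrt (2 * pi * \<beta> n * real n))"
proof (rule asymp_equivI')
  define d where "d n = sqrt n * (2 * pi * x n) - sqrt (2 * pi / \<beta> n)" for n
  have "(\<lambda>n. of_real (sqrt n) * of_real (2 * pi * x n) - complex_of_real (sqrt (2 * pi / \<beta> n))) \<longlonglongrightarrow> 0"
    by (rule local_limit[OF assms(1-4,6-9)])
  then have "(\<lambda>n. Re (of_real (sqrt n) * of_real (2 * pi * x n) - complex_of_real (sqrt (2 * pi / \<beta> n)))) \<longlonglongrightarrow> Re 0"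
    by (rule tendsto_Re)
  then have lim: "d \<longlonglongrightarrow> 0"
    by (simp add: d_def[abs_def])
  \<comment> \<open>The multiplier is the reciprocal of the main term
    \<open>sqrt (2 * pi / \<beta> n)\<close> and is bounded in terms of \<open>B\<close>.\<close>
  have "(\<lambda>n. sqrt (\<beta> n / (2 * pi)) * d n) \<longlonglongrightarrow> 0"
  proof (rule Lim_null_comparison)
    show "(\<lambda>n. sqrt (B / (2 * pi)) * norm (d n)) \<longlonglongrightarrow> 0"
      using tendsto_mult_right_zero[OF tendsto_norm_zero[OF lim]] .
    show "eventually (\<lambda>n. norm (sqrt (\<beta> n / (2 * pi)) * d n) \<le> sqrt (B / (2 * pi)) * norm (d n)) sequentially"
      using eventually_ge_at_top[of n0]
    proof eventually_elim
      case (elim n)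
      have "0 \<le> \<beta> n" using \<beta>(1)[OF elim] assms(2) by linarith
      then have "0 \<le> sqrt (\<beta> n / (2 * pi))" "sqrt (\<beta> n / (2 * pi)) \<le> sqrt (B / (2 * pi))"
        using \<beta>(2)[OF elim] by (auto intro!: divide_right_mono)
      then show ?case
        unfolding norm_mult by (intro mult_right_mono) simp_all
    qed
  qed
  then have "(\<lambda>n. 1 + sqrt (\<beta> n / (2 * pi)) * d n) \<longlonglongrightarrow> 1 + 0"
    by (intro tendsto_intros)
  moreover have "eventually (\<lambda>n. 1 + sqrt (\<beta> n / (2 * pi)) * d n = x n / (1 / sqrt (2 * pi * \<beta> n * real n))) sequentially"
    using eventually_ge_at_top[of n0]
  proof eventually_elim
    case (elim n)
    have \<beta>pos: "\<beta> n > 0" using \<beta>(1)[OF elim] assms(2) by linarith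
    have 1: "sqrt (\<beta> n / (2 * pi)) * sqrt (2 * pi / \<beta> n) = 1"
      using \<beta>pos by (simp flip: real_sqrt_mult)
    have "sqrt (\<beta> n / (2 * pi)) * (2 * pi) = sqrt (\<beta> n / (2 * pi)) * sqrt ((2 * pi)\<^sup>2)"
      by (subst real_sqrt_abs) simp
    also have "\<dots> = sqrt (2 * pi * \<beta> n)"
      unfolding real_sqrt_mult[symmetric] by (simp add: power2_eq_square)
    finally have 2: "sqrt (\<beta> n / (2 * pi)) * (2 * pi) * sqrt n = sqrt (2 * pi * \<beta> n * real n)"
      by (simp add: real_sqrt_mult)
    have "1 + a * (y * (p * z) - b) = a * p * y * z + (1 - a * b)" for a b p y z :: real
      by (simp add: algebra_simps)
    then have "1 + sqrt (\<beta> n / (2 * pi)) * d n = sqrt (\<beta> n / (2 * pi)) * (2 * pi) * sqrt n * x n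
        + (1 - sqrt (\<beta> n / (2 * pi)) * sqrt (2 * pi / \<beta> n))"
      unfolding d_def .
    then show ?case unfolding 1 2 by simp
  qed
  ultimately show "(\<lambda>n. x n / (1 / sqrt (2 * pi * \<beta> n * real n))) \<longlonglongrightarrow> 1"
    by (simp add: tendsto_cong)
qed

section \<open>Bounds for characteristic functions\<close>

text \<open>By Taylor expansion \<open>cos \<theta>\<close> is at most
  \<open>1 - \<theta>^2 / 2 + \<theta>^4 / 24\<close>, and \<open>pi^2 \<le> 10\<close> on this
  range; the constant is \<open>1 / 2 - 10 / 24 = 1 / 12\<close>.\<close>

lemma cos_le_quadratic:
  assumes "\<bar>\<theta>\<bar> \<le> pi"
  shows "1 - cos \<theta> \<ge> \<theta>\<^sup>2 / 12"
proof -
  have "cmod (cis \<theta> - (\<Sum>k\<le>3. (\<i> * of_real \<theta>) ^ k / fact k)) \<le> \<bar>\<theta>\<bar> ^ 4 / 24"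
    using iexp_approx1[of \<theta> 3] by (simp add: cis_conv_exp fact_numeral)
  then have "Re (cis \<theta> - (\<Sum>k\<le>3. (\<i> * of_real \<theta>) ^ k / fact k)) \<le> \<bar>\<theta>\<bar> ^ 4 / 24"
    using complex_Re_le_cmod order_trans by blast
  moreover have "Re (\<Sum>k\<le>3. (\<i> * of_real \<theta>) ^ k / fact k) = 1 - \<theta>\<^sup>2 / 2"
    by (simp add: eval_nat_numeral)
  ultimately have 1: "cos \<theta> \<le> 1 - \<theta>\<^sup>2 / 2 + \<theta> ^ 4 / 24"
    by (simp add: power_even_abs)
  have "\<theta>\<^sup>2 \<le> pi\<^sup>2"
    using assms by (metis abs_le_square_iff abs_of_pos pi_gt_zero)
  also have "pi\<^sup>2 \<le> 3.15\<^sup>2"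
    using pi_approx by (intro power_mono) auto
  also have "3.15\<^sup>2 \<le> (10 :: real)" by (simp add: power2_eq_square)
  finally have "\<theta>\<^sup>2 * \<theta>\<^sup>2 \<le> 10 * \<theta>\<^sup>2" by (intro mult_right_mono) auto
  then have "\<theta> ^ 4 \<le> 10 * \<theta>\<^sup>2" by (simp add: power4_eq_xxxx power2_eq_square mult.assoc)
  then show ?thesis using 1 by simp
qed

text \<open>The squared norm is \<open>(a + b)^2 - 2 a b (1 - cos \<theta>)\<close>; since
  \<open>a + b \<le> 1\<close>, it is at most the square of the right-hand side.\<close>

lemma norm_two_term_cis:
  assumes "a \<ge> 0" "b \<ge> 0" "a + b \<le> 1"
  shows "cmod (of_real a + of_real b * cis \<theta>) \<le> a + b - a * b * (1 - cos \<theta>)"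
proof (rule power2_le_imp_le)
  define t where "t = 1 - cos \<theta>"
  have t: "0 \<le> t" "t \<le> 2" using cos_le_one[of \<theta>] cos_ge_minus_one[of \<theta>] by (auto simp: t_def)
  have "(cmod (of_real a + of_real b * cis \<theta>))\<^sup>2 = (a + b * cos \<theta>)\<^sup>2 + (b * sin \<theta>)\<^sup>2"
    by (simp add: cmod_power2)
  also have "\<dots> = a\<^sup>2 + 2 * a * b * cos \<theta> + b\<^sup>2 * ((cos \<theta>)\<^sup>2 + (sin \<theta>)\<^sup>2)"
    by algebra
  also have "\<dots> = (a + b)\<^sup>2 - 2 * (a * b * t)"
    unfolding sin_cos_squared_add2 by (simp add: t_def power2_eq_square algebra_simps)
  also have "\<dots> \<le> (a + b)\<^sup>2 - 2 * (a + b) * (a * b * t) + (a * b * t)\<^sup>2"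
  proof -
    have "(a + b) * (a * b * t) \<le> 1 * (a * b * t)"
      using assms t by (intro mult_right_mono) auto
    then show ?thesis using zero_le_power2[of "a * b * t"] by linarith
  qed
  also have "\<dots> = (a + b - a * b * t)\<^sup>2" by (simp add: power2_eq_square algebra_simps)
  finally show "(cmod (of_real a + of_real b * cis \<theta>))\<^sup>2 \<le> (a + b - a * b * (1 - cos \<theta>))\<^sup>2"
    by (simp add: t_def)
  have "a * b * t \<le> a * b * 2" using assms t by (intro mult_left_mono) auto
  moreover have "a * b \<le> a" "a * b \<le> b"
    using assms by (auto intro: mult_left_le mult_left_le_one_le)
  ultimately show "a + b - a * b * (1 - cos \<theta>) \<ge> 0" by (simp add: t_def)
qed

text \<open>
  The characteristic function of \<open>X + Y - 1\<close>, for independent \<open>X\<close> with distribution \<open>q\<close>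
  and \<open>Y\<close> Poisson with parameter \<open>s\<close>.
\<close>

definition charfun :: "nat \<Rightarrow> (nat \<Rightarrow> real) \<Rightarrow> real \<Rightarrow> real \<Rightarrow> complex" where
  "charfun D q s \<theta> =
     (\<Sum>k<D. of_real (q k) * cis (real k * \<theta>)) * exp (of_real s * (cis \<theta> - 1)) * cis (- \<theta>)"

text \<open>The decay comes from the two atoms 0 and 1 of \<open>q\<close> alone. The other atoms
  are estimated by their total mass, and the remaining two factors have norm at most 1.\<close>

lemma norm_charfun_le:
  assumes "D \<ge> 2" "s \<ge> 0" "\<And>k. q k \<ge> 0" "(\<Sum>k<D. q k) = 1"
  shows "cmod (charfun D q s \<theta>) \<le> exp (- (q 0 * q 1 * (1 - cos \<theta>)))"
proof -
  let ?g = "\<lambda>k. of_real (q k) * cis (real k * \<theta>)"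
  have split: "{..<D} = {0, 1} \<union> {2..<D}" using assms(1) by auto
  have q: "q 0 + q 1 + (\<Sum>k=2..<D. q k) = 1"
    using assms(4) unfolding split by (subst (asm) sum.union_disjoint) auto
  have rest: "(\<Sum>k=2..<D. q k) \<ge> 0" by (intro sum_nonneg assms)
  have "cmod (\<Sum>k<D. ?g k) = cmod ((of_real (q 0) + of_real (q 1) * cis \<theta>) + (\<Sum>k=2..<D. ?g k))"
    unfolding split by (subst sum.union_disjoint) auto
  also have "\<dots> \<le> cmod (of_real (q 0) + of_real (q 1) * cis \<theta>) + cmod (\<Sum>k=2..<D. ?g k)"
    by (rule norm_triangle_ineq)
  also have "cmod (\<Sum>k=2..<D. ?g k) \<le> (\<Sum>k=2..<D. q k)"
    using assms(3) by (intro order_trans[OF norm_sum] sum_mono) (simp add: norm_mult)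
  also have "cmod (of_real (q 0) + of_real (q 1) * cis \<theta>) \<le> q 0 + q 1 - q 0 * q 1 * (1 - cos \<theta>)"
    using assms(3) q rest by (intro norm_two_term_cis) auto
  finally have "cmod (\<Sum>k<D. ?g k) \<le> 1 + - (q 0 * q 1 * (1 - cos \<theta>))"
    using q by linarith
  also have "\<dots> \<le> exp (- (q 0 * q 1 * (1 - cos \<theta>)))" by (rule exp_ge_add_one_self)
  finally have 1: "cmod (\<Sum>k<D. ?g k) \<le> exp (- (q 0 * q 1 * (1 - cos \<theta>)))" .
  have "s * cos \<theta> \<le> s * 1" using assms(2) by (intro mult_left_mono) auto
  then have 2: "cmod (exp (of_real s * (cis \<theta> - 1))) \<le> 1"
    by (simp add: algebra_simps)
  have "cmod (charfun D q s \<theta>) = cmod (\<Sum>k<D. ?g k) * cmod (exp (of_real s * (cis \<theta> - 1)))"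
    by (simp only: charfun_def norm_mult norm_cis mult_1_right)
  also have "\<dots> \<le> exp (- (q 0 * q 1 * (1 - cos \<theta>))) * 1"
    by (intro mult_mono 1 2) auto
  finally show ?thesis by simp
qed

text \<open>On the left half plane, which is convex, the derivative of \<open>exp\<close> has norm
  at most 1.\<close>

lemma norm_exp_diff_le:
  assumes "Re a \<le> 0" "Re b \<le> 0"
  shows "cmod (exp a - exp b) \<le> cmod (a - b)"
proof -
  have "norm (exp a - exp b) \<le> 1 * norm (a - b)"
  proof (rule field_differentiable_bound[of "{z. Re z \<le> 0}"])
    show "convex {z. Re z \<le> 0}" by (rule convex_halfspace_Re_le)
    show "(exp has_field_derivative exp z) (at z within {z. Re z \<le> 0})" for z
      by (intro DERIV_subset[OF DERIV_exp]) auto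
  qed (use assms in auto)
  then show ?thesis by simp
qed

lemma cis_taylor2: "cmod (cis x - (1 + \<i> * x - of_real (x\<^sup>2 / 2))) \<le> \<bar>x\<bar> ^ 3 / 6"
  using iexp_approx1[of x 2]
  by (simp add: cis_conv_exp fact_numeral eval_nat_numeral algebra_simps)

text \<open>The factor of \<open>X\<close> and the Poisson factor are each compared with the
  exponential of a quadratic having the same mean and variance. The total mean is 1, so the shift by
  \<open>-1\<close> cancels the linear terms. The constant depends on \<open>D\<close> only, which
  makes the estimate uniform in \<open>q\<close> and \<open>s\<close>.\<close>

lemma charfun_approx:
  assumes "s \<ge> 0" "\<And>k. q k \<ge> 0" "(\<Sum>k<D. q k) = 1" and mean: "(\<Sum>k<D. real k * q k) + s = 1"
    and \<beta>: "\<beta> = (\<Sum>k<D. (real k)\<^sup>2 * q k) - (\<Sum>k<D. real k * q k)\<^sup>2 + s" and "\<bar>\<theta>\<bar> \<le> 1"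
  shows "cmod (charfun D q s \<theta> - of_real (exp (- (\<beta> * \<theta>\<^sup>2 / 2))))
    \<le> (2 * real D ^ 3 + exp (real D ^ 2) * (real D + real D ^ 2) ^ 3 + real D ^ 4 + 1) * \<bar>\<theta>\<bar> ^ 3"
proof -
  define d where "d = real D"
  define \<mu> where "\<mu> = (\<Sum>k<D. real k * q k)"
  define m2 where "m2 = (\<Sum>k<D. (real k)\<^sup>2 * q k)"
  define v where "v = m2 - \<mu>\<^sup>2"
  define t where "t = \<bar>\<theta>\<bar>"
  have t: "0 \<le> t" "t \<le> 1" using assms by (auto simp: t_def)
  have d: "d \<ge> 0" by (simp add: d_def)
  have moment: "(\<Sum>k<D. real k ^ m * q k) \<le> d ^ m" for m
  proof -
    have "(\<Sum>k<D. real k ^ m * q k) \<le> (\<Sum>k<D. d ^ m * q k)"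
      using assms(2) by (intro sum_mono mult_right_mono power_mono) (auto simp: d_def)
    also have "\<dots> = d ^ m" using assms(3) by (simp flip: sum_distrib_left)
    finally show ?thesis .
  qed
  have \<mu>: "0 \<le> \<mu>" "\<mu> \<le> d" "\<mu> \<le> 1"
    using moment[of 1] mean assms(1,2) by (auto simp: \<mu>_def intro: sum_nonneg)
  have m2: "m2 \<le> d\<^sup>2" using moment[of 2] by (simp add: m2_def)
  have s: "s = 1 - \<mu>" "s \<le> 1" using mean \<mu> by (auto simp: \<mu>_def)
  have v: "0 \<le> v" "v \<le> d\<^sup>2"
  proof -
    have "0 \<le> (\<Sum>k<D. (real k - \<mu>)\<^sup>2 * q k)" using assms(2) by (intro sum_nonneg) auto
    also have "\<dots> = m2 - 2 * \<mu> * \<mu> + \<mu>\<^sup>2 * (\<Sum>k<D. q k)"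
      unfolding m2_def \<mu>_def
      by (simp add: power2_diff algebra_simps sum.distrib sum_subtractf sum_distrib_left sum_distrib_right)
    also have "\<dots> = v" using assms(3) by (simp add: v_def power2_eq_square)
    finally show "0 \<le> v" .
    show "v \<le> d\<^sup>2" using m2 by (simp add: v_def) (smt (verit) zero_le_power2)
  qed
  have pw: "t ^ m \<le> t ^ 3" if "m \<ge> 3" for m
    using t that by (intro power_decreasing) auto
  define A where "A = (\<Sum>k<D. of_real (q k) * cis (real k * \<theta>))"
  \<comment> \<open>\<open>A1\<close> is the second-order Taylor polynomial of \<open>A\<close>;
    \<open>u\<close> is the quadratic part of the logarithm of \<open>A\<close>, with mean
    \<open>\<mu>\<close> and variance \<open>v\<close>.\<close>
  define A1 where "A1 = 1 + \<i> * of_real (\<mu> * \<theta>) - complex_of_real (m2 * \<theta>\<^sup>2 / 2)"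
  define u where "u = Complex (- (v * \<theta>\<^sup>2 / 2)) (\<mu> * \<theta>)"
  have AA1: "cmod (A - A1) \<le> d ^ 3 * t ^ 3"
  proof -
    have A1_eq: "A1 = (\<Sum>k<D. of_real (q k) * (1 + \<i> * of_real (real k * \<theta>) - of_real ((real k * \<theta>)\<^sup>2 / 2)))"
    proof -
      have "(\<Sum>k<D. of_real (q k) * (1 + \<i> * of_real (real k * \<theta>) - complex_of_real ((real k * \<theta>)\<^sup>2 / 2))) =
          of_real (\<Sum>k<D. q k) + \<i> * of_real ((\<Sum>k<D. real k * q k) * \<theta>)
            - complex_of_real ((\<Sum>k<D. (real k)\<^sup>2 * q k) * \<theta>\<^sup>2 / 2)"
        by (simp add: sum.distrib sum_subtractf sum_distrib_left sum_distrib_right sum_divide_distrib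
            algebra_simps power_mult_distrib)
      then show ?thesis using assms(3) by (simp add: A1_def \<mu>_def m2_def)
    qed
    have "cmod (A - A1) \<le> (\<Sum>k<D. cmod (of_real (q k) *
        (cis (real k * \<theta>) - (1 + \<i> * of_real (real k * \<theta>) - of_real ((real k * \<theta>)\<^sup>2 / 2)))))"
      unfolding A_def A1_eq sum_subtractf[symmetric] right_diff_distrib[symmetric] by (rule norm_sum)
    also have "\<dots> \<le> (\<Sum>k<D. q k * (real k ^ 3 * t ^ 3))"
    proof (rule sum_mono)
      fix k
      have "cmod (cis (real k * \<theta>) - (1 + \<i> * of_real (real k * \<theta>) - of_real ((real k * \<theta>)\<^sup>2 / 2)))
          \<le> \<bar>real k * \<theta>\<bar> ^ 3 / 6" by (rule cis_taylor2)
      also have "\<dots> \<le> real k ^ 3 * t ^ 3"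
        using t by (simp add: abs_mult power_mult_distrib t_def)
      finally show "cmod (of_real (q k) *
        (cis (real k * \<theta>) - (1 + \<i> * of_real (real k * \<theta>) - of_real ((real k * \<theta>)\<^sup>2 / 2))))
          \<le> q k * (real k ^ 3 * t ^ 3)"
        unfolding norm_mult using assms(2) by (simp add: mult_left_mono)
    qed
    also have "\<dots> = (\<Sum>k<D. real k ^ 3 * q k) * t ^ 3"
      unfolding sum_distrib_right by (intro sum.cong) (simp_all add: mult_ac)
    also have "\<dots> \<le> d ^ 3 * t ^ 3" using t by (intro mult_right_mono moment) auto
    finally show ?thesis .
  qed
  \<comment> \<open>One factor \<open>t\<close> is given away using \<open>t \<le> 1\<close>, so
    that both parts of \<open>u\<close> are bounded linearly in \<open>t\<close> and the cube of its
    norm is of order \<open>t^3\<close>.\<close>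
  have Re_u: "Re u \<le> 0" "\<bar>Re u\<bar> \<le> d\<^sup>2 * t"
  proof -
    show "Re u \<le> 0" using v by (simp add: u_def)
    have "\<bar>Re u\<bar> = v * t\<^sup>2 / 2" using v by (simp add: u_def t_def abs_mult)
    also have "\<dots> \<le> d\<^sup>2 * t\<^sup>2" using v t by (smt (verit) field_sum_of_halves mult_nonneg_nonneg mult_right_mono zero_le_power2)
    also have "\<dots> \<le> d\<^sup>2 * t" using t by (intro mult_left_mono) (auto simp: power2_eq_square mult_left_le)
    finally show "\<bar>Re u\<bar> \<le> d\<^sup>2 * t" .
  qed
  have norm_u: "cmod u \<le> (d + d\<^sup>2) * t"
  proof -
    have "\<bar>Im u\<bar> \<le> d * t" using \<mu> t by (simp add: u_def abs_mult t_def mult_right_mono)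
    then show ?thesis using cmod_le[of u] Re_u by (simp add: algebra_simps)
  qed
  have A1u: "cmod (exp u - A1) \<le> exp (d\<^sup>2) * (d + d\<^sup>2) ^ 3 * t ^ 3 + (d ^ 3 * t ^ 3 + d ^ 4 * t ^ 3)"
  proof -
    have "cmod (exp u - (1 + u + u\<^sup>2 / 2)) \<le> exp \<bar>Re u\<bar> * cmod u ^ 3 / 2"
      using Taylor_exp[of u 2] by (simp add: eval_nat_numeral)
    also have "\<dots> \<le> exp \<bar>Re u\<bar> * cmod u ^ 3" by simp
    also have "\<dots> \<le> exp (d\<^sup>2) * ((d + d\<^sup>2) * t) ^ 3"
    proof (intro mult_mono power_mono norm_u)
      have "d\<^sup>2 * t \<le> d\<^sup>2 * 1" using t by (intro mult_left_mono) auto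
      then show "exp \<bar>Re u\<bar> \<le> exp (d\<^sup>2)" using Re_u by simp
    qed auto
    finally have 1: "cmod (exp u - (1 + u + u\<^sup>2 / 2)) \<le> exp (d\<^sup>2) * (d + d\<^sup>2) ^ 3 * t ^ 3"
      by (simp add: power_mult_distrib mult.assoc)
    \<comment> \<open>The terms up to second order cancel because \<open>v + \<mu>^2 = m2\<close>;
      only cubic and quartic ones remain.\<close>
    have eq: "1 + u + u\<^sup>2 / 2 - A1 = Complex (v\<^sup>2 * \<theta> ^ 4 / 8) (- (\<mu> * v * \<theta> ^ 3 / 2))"
      by (simp add: complex_eq_iff u_def A1_def v_def power2_eq_square eval_nat_numeral field_simps)
    have "\<bar>v\<^sup>2 * \<theta> ^ 4 / 8\<bar> \<le> d ^ 4 * t ^ 3"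
    proof -
      have "\<bar>v\<^sup>2 * \<theta> ^ 4 / 8\<bar> = v\<^sup>2 * t ^ 4 / 8" by (simp add: abs_mult t_def power_abs)
      also have "\<dots> \<le> v\<^sup>2 * t ^ 4" using t by simp
      also have "\<dots> \<le> (d\<^sup>2)\<^sup>2 * t ^ 3" using v t by (intro mult_mono power_mono pw) auto
      finally show ?thesis by (simp flip: power_mult)
    qed
    moreover have "\<bar>- (\<mu> * v * \<theta> ^ 3 / 2)\<bar> \<le> d ^ 3 * t ^ 3"
    proof -
      have "\<bar>- (\<mu> * v * \<theta> ^ 3 / 2)\<bar> = \<mu> * v * t ^ 3 / 2"
        using \<mu> v by (simp add: abs_mult t_def power_abs)
      also have "\<dots> \<le> \<mu> * v * t ^ 3" using \<mu> v t by simp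
      also have "\<dots> \<le> d * d\<^sup>2 * t ^ 3" using \<mu> v t d by (intro mult_right_mono mult_mono) auto
      finally show ?thesis by (simp add: power3_eq_cube power2_eq_square)
    qed
    ultimately have 2: "cmod (1 + u + u\<^sup>2 / 2 - A1) \<le> d ^ 3 * t ^ 3 + d ^ 4 * t ^ 3"
      unfolding eq using cmod_le[of "Complex (v\<^sup>2 * \<theta> ^ 4 / 8) (- (\<mu> * v * \<theta> ^ 3 / 2))"] by simp
    have "exp u - A1 = (exp u - (1 + u + u\<^sup>2 / 2)) + (1 + u + u\<^sup>2 / 2 - A1)" by simp
    then show ?thesis
      using norm_triangle_ineq[of "exp u - (1 + u + u\<^sup>2 / 2)" "1 + u + u\<^sup>2 / 2 - A1"] 1 2 by simp
  qed
  have Au: "cmod (A - exp u) \<le> (2 * d ^ 3 + exp (d\<^sup>2) * (d + d\<^sup>2) ^ 3 + d ^ 4) * t ^ 3"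
    using norm_triangle_ineq4[of "A - A1" "exp u - A1"] AA1 A1u by (simp add: algebra_simps)
  define B where "B = exp (of_real s * (cis \<theta> - 1))"
  \<comment> \<open>A Poisson variable has mean and variance both equal to \<open>s\<close>.\<close>
  define w where "w = Complex (- (s * \<theta>\<^sup>2 / 2)) (s * \<theta>)"
  have BB: "cmod (B - exp w) \<le> t ^ 3"
  proof -
    have "s * cos \<theta> \<le> s * 1" using assms(1) by (intro mult_left_mono) auto
    then have "cmod (B - exp w) \<le> cmod (of_real s * (cis \<theta> - 1) - w)"
      unfolding B_def using assms(1) by (intro norm_exp_diff_le) (auto simp: w_def algebra_simps)
    also have "of_real s * (cis \<theta> - 1) - w = of_real s * (cis \<theta> - (1 + \<i> * \<theta> - of_real (\<theta>\<^sup>2 / 2)))"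
      by (simp add: w_def complex_eq_iff algebra_simps)
    also have "cmod \<dots> \<le> 1 * (t ^ 3 / 6)"
    proof -
      have "cmod (of_real s) \<le> 1" using s(2) assms(1) by simp
      then show ?thesis
        unfolding norm_mult using cis_taylor2[of \<theta>, folded t_def] by (intro mult_mono) auto
    qed
    also have "\<dots> \<le> t ^ 3" using t by simp
    finally show ?thesis .
  qed
  have normA: "cmod A \<le> 1"
    unfolding A_def using assms(2,3) by (intro order_trans[OF norm_sum]) (simp add: norm_mult)
  have normw: "cmod (exp w) \<le> 1" using assms(1) by (simp add: w_def)
  \<comment> \<open>The linear terms of \<open>u\<close> and \<open>w\<close> add up to
    \<open>\<i> * \<theta>\<close>, as \<open>\<mu> + s = 1\<close>, and are cancelled by
    \<open>cis (- \<theta>)\<close>; the variances add up to \<open>\<beta>\<close>.\<close>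
  have gauss: "of_real (exp (- (\<beta> * \<theta>\<^sup>2 / 2))) = exp u * exp w * cis (- \<theta>)"
  proof -
    have "exp u * exp w * cis (- \<theta>) = exp (u + w + \<i> * of_real (- \<theta>))"
      by (simp only: exp_add cis_conv_exp)
    also have "u + w + \<i> * of_real (- \<theta>) = complex_of_real (- (\<beta> * \<theta>\<^sup>2 / 2))"
    proof -
      have *: "\<beta> = v + s" by (simp add: \<beta> v_def m2_def \<mu>_def)
      show ?thesis
        unfolding * by (simp add: complex_eq_iff u_def w_def s(1) algebra_simps add_divide_distrib diff_divide_distrib)
    qed
    also have "exp \<dots> = complex_of_real (exp (- (\<beta> * \<theta>\<^sup>2 / 2)))" by (rule exp_of_real)
    finally show ?thesis by simp
  qed
  \<comment> \<open>Replacing one factor at a time leaves the cofactors \<open>A\<close> and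
    \<open>exp w\<close>, both of norm at most 1.\<close>
  have "charfun D q s \<theta> - of_real (exp (- (\<beta> * \<theta>\<^sup>2 / 2))) =
      (A * (B - exp w) + (A - exp u) * exp w) * cis (- \<theta>)"
    unfolding gauss charfun_def A_def[symmetric] B_def[symmetric] by (simp add: algebra_simps)
  then have "cmod (charfun D q s \<theta> - of_real (exp (- (\<beta> * \<theta>\<^sup>2 / 2)))) =
      cmod (A * (B - exp w) + (A - exp u) * exp w)"
    by (simp add: norm_mult)
  also have "\<dots> \<le> cmod A * cmod (B - exp w) + cmod (A - exp u) * cmod (exp w)"
    by (intro order_trans[OF norm_triangle_ineq]) (simp add: norm_mult)
  also have "\<dots> \<le> 1 * t ^ 3 + (2 * d ^ 3 + exp (d\<^sup>2) * (d + d\<^sup>2) ^ 3 + d ^ 4) * t ^ 3 * 1"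
    using t d by (intro add_mono mult_mono normA BB Au normw) auto
  finally show ?thesis by (simp add: d_def t_def algebra_simps)
qed

section \<open>Saddle point asymptotics\<close>

text \<open>Cauchy's formula for the \<open>N\<close>-th derivative at 0 on the circle of radius
  \<open>r\<close>. The symmetric interval is obtained by periodicity.\<close>

lemma coeff_has_integral:
  fixes f :: "complex \<Rightarrow> complex"
  assumes "f has_fps_expansion F" "f holomorphic_on UNIV" "r > 0"
  shows "((\<lambda>t. f (of_real r * cis t) * cis (- (real N * t))) has_integral
    (of_real (2 * pi * r ^ N) * fps_nth F N)) {-pi..pi}"
proof -
  define g where "g t = f (of_real r * cis t) * cis (- (real N * t))" for t
  have g_alt: "g t = f (of_real r * cis t) / cis t ^ N" for t
  proof -
    have "cis (- (real N * t)) = inverse (cis t ^ N)"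
      by (simp only: Complex.DeMoivre cis_inverse)
    then show ?thesis by (simp add: g_def divide_inverse)
  qed
  have g_per: "g (t + 2 * pi) = g t" for t
    by (simp add: g_alt cis_mult[symmetric])
  have g_cont: "continuous_on A g" for A
    unfolding g_def
    by (intro continuous_intros continuous_on_compose2[OF holomorphic_on_imp_continuous_on[OF assms(2)]]) auto
  define J where "J = of_real (2 * pi * r ^ N) * fps_nth F N"
  have "((\<lambda>u. f u / (u - 0) ^ Suc N) has_contour_integral
      ((2 * pi * \<i>) / fact N * (deriv ^^ N) f 0)) (circlepath 0 r)"
    using assms by (intro Cauchy_has_contour_integral_higher_derivative_circlepath)
      (auto intro: holomorphic_on_imp_continuous_on holomorphic_on_subset)
  then have "((\<lambda>t. f (0 + of_real r * cis t) / (0 + of_real r * cis t - 0) ^ Suc N * of_real r * \<i> * cis t)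
      has_integral (2 * pi * \<i>) / fact N * (deriv ^^ N) f 0) {0..2 * pi}"
    unfolding circlepath_def by (subst (asm) has_contour_integral_part_circlepath_iff) auto
  then have "((\<lambda>t. (of_real r ^ N / \<i>) * (f (0 + of_real r * cis t) / (0 + of_real r * cis t - 0) ^ Suc N * of_real r * \<i> * cis t))
      has_integral (of_real r ^ N / \<i>) * ((2 * pi * \<i>) / fact N * (deriv ^^ N) f 0)) {0..2 * pi}"
    by (rule has_integral_mult_right)
  moreover have "(of_real r ^ N / \<i>) * (f (0 + of_real r * cis t) / (0 + of_real r * cis t - 0) ^ Suc N * of_real r * \<i> * cis t) = g t" for t
    using assms(3) by (simp add: g_alt field_simps)
  moreover have "(of_real r ^ N / \<i>) * ((2 * pi * \<i>) / fact N * (deriv ^^ N) f 0) = J"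
    by (simp add: J_def fps_nth_fps_expansion[OF assms(1)] field_simps)
  ultimately have J: "(g has_integral J) {0..2 * pi}" by simp
  \<comment> \<open>The half over \<open>[pi, 2 pi]\<close> is moved by one period to
    \<open>[-pi, 0]\<close>.\<close>
  define J1 J2 where "J1 = integral {0..pi} g" and "J2 = integral {pi..2 * pi} g"
  have J1: "(g has_integral J1) {0..pi}" and J2: "(g has_integral J2) {pi..2 * pi}"
    unfolding J1_def J2_def by (intro integrable_integral integrable_continuous_real g_cont)+
  have "(g has_integral (J1 + J2)) {0..2 * pi}"
    by (rule has_integral_combine[OF _ _ J1 J2]) auto
  then have J_eq: "J = J2 + J1" using has_integral_unique[OF J] by simp
  have "((\<lambda>t. g (t + 2 * pi)) has_integral J2) {pi - 2 * pi..2 * pi - 2 * pi}"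
    using J2 by (subst (asm) has_integral_shift_real_ivl_iff[where c = "2 * pi"])
  then have "(g has_integral J2) {-pi..0}" by (simp add: g_per)
  then have "(g has_integral (J2 + J1)) {-pi..pi}"
    by (intro has_integral_combine[OF _ _ _ J1]) auto
  then show ?thesis by (simp add: J_eq[symmetric] J_def g_def[abs_def])
qed

lemma coeff_map_poly_of_real_power:
  "coeff (map_poly complex_of_real p ^ n) i = of_real (coeff (p ^ n) i)"
  by (induction n arbitrary: i) (simp_all add: coeff_mult coeff_map_poly)

text \<open>By the Cauchy product the sum is the \<open>N\<close>-th coefficient of
  \<open>\<gamma>(x)^n exp(w x)\<close>, an entire function.\<close>

lemma coeff_gamma_poly_power_exp_integral:
  assumes "r > 0"
  shows "((\<lambda>t. (\<Sum>k<\<Delta>. (of_real r * cis t) ^ k / fact k) ^ n * exp (of_real w * (of_real r * cis t))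
      * cis (- (real N * t))) has_integral
    complex_of_real (2 * pi * r ^ N * (\<Sum>k\<le>N. w ^ k / fact k * coeff (gamma_poly \<Delta> ^ n) (N - k)))) {-pi..pi}"
proof -
  define P where "P = map_poly complex_of_real (gamma_poly \<Delta>)"
  have P: "poly P z = (\<Sum>k<\<Delta>. z ^ k / fact k)" for z
  proof -
    have "P = (\<Sum>k<\<Delta>. monom (1 / fact k) k)"
      by (rule poly_eqI) (simp add: P_def coeff_map_poly gamma_poly_def coeff_sum)
    then show ?thesis by (simp add: poly_sum poly_monom)
  qed
  have "poly P has_fps_expansion fps_of_poly P"
    unfolding has_fps_expansion_def by simp
  then have ex: "(\<lambda>z. poly P z ^ n * exp (of_real w * z)) has_fps_expansion (fps_of_poly P ^ n * fps_exp (of_real w))"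
    by (intro fps_expansion_intros)
  have hol: "(\<lambda>z. poly P z ^ n * exp (of_real w * z)) holomorphic_on UNIV"
    by (intro holomorphic_intros)
  have nth: "fps_nth (fps_of_poly P ^ n * fps_exp (of_real w)) N =
      complex_of_real (\<Sum>k\<le>N. w ^ k / fact k * coeff (gamma_poly \<Delta> ^ n) (N - k))"
    by (subst mult.commute)
       (simp add: fps_mult_nth atLeast0AtMost P_def coeff_map_poly_of_real_power flip: fps_of_poly_power)
  show ?thesis
    using coeff_has_integral[OF ex hol assms, of N] unfolding nth of_real_mult[symmetric] P .
qed

section \<open>Moments and a priori bounds at the saddle point\<close>

lemma pderiv_sum: "pderiv (\<Sum>i\<in>A. p i) = (\<Sum>i\<in>A. pderiv (p i))"
  using higher_pderiv_sum[of 1 p A] by simp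

text \<open>For the weights \<open>x^k / k!\<close> these are the unnormalised mean and second
  factorial moment; they translate the saddle equation and \<open>saddle_beta\<close> into
  probabilistic terms.\<close>

lemma pderiv_gamma_poly_moments:
  "x * poly (pderiv (gamma_poly \<Delta>)) x = (\<Sum>k<\<Delta>. real k * (x ^ k / fact k))"
  "x\<^sup>2 * poly (pderiv (pderiv (gamma_poly \<Delta>))) x =
    (\<Sum>k<\<Delta>. (real k)\<^sup>2 * (x ^ k / fact k)) - (\<Sum>k<\<Delta>. real k * (x ^ k / fact k))"
proof -
  have 1: "x * (real k * x ^ (k - 1)) = real k * x ^ k" for k
    by (cases k) simp_all
  have 2: "x\<^sup>2 * (real k * real (k - 1) * x ^ (k - 2)) = ((real k)\<^sup>2 - real k) * x ^ k" for k
  proof (cases "k < 2")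
    case True
    then have "k = 0 \<or> k = 1" by auto
    then show ?thesis by auto
  next
    case False
    then obtain m where "k = Suc (Suc m)" by (metis add_2_eq_Suc le_Suc_ex not_less)
    then show ?thesis by (simp add: power2_eq_square algebra_simps)
  qed
  show "x * poly (pderiv (gamma_poly \<Delta>)) x = (\<Sum>k<\<Delta>. real k * (x ^ k / fact k))"
    unfolding gamma_poly_def pderiv_sum poly_sum sum_distrib_left
    by (intro sum.cong refl) (use 1 in \<open>simp add: pderiv_monom poly_monom\<close>)
  show "x\<^sup>2 * poly (pderiv (pderiv (gamma_poly \<Delta>))) x =
    (\<Sum>k<\<Delta>. (real k)\<^sup>2 * (x ^ k / fact k)) - (\<Sum>k<\<Delta>. real k * (x ^ k / fact k))"
    unfolding gamma_poly_def pderiv_sum poly_sum sum_distrib_left sum_subtractf[symmetric]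
  proof (intro sum.cong refl)
    fix k
    have "x\<^sup>2 * poly (pderiv (pderiv (monom (1 / fact k) k))) x =
        x\<^sup>2 * (real k * real (k - 1) * x ^ (k - 2)) / fact k"
      by (simp add: pderiv_monom poly_monom mult_ac numeral_2_eq_2)
    then show "x\<^sup>2 * poly (pderiv (pderiv (monom (1 / fact k) k))) x =
        (real k)\<^sup>2 * (x ^ k / fact k) - real k * (x ^ k / fact k)"
      unfolding 2 by (simp add: algebra_simps diff_divide_distrib)
  qed
qed

lemma poly_gamma_poly_mono:
  assumes "D \<le> \<Delta>" "0 \<le> x" "x \<le> y"
  shows "poly (gamma_poly D) x \<le> poly (gamma_poly \<Delta>) y"
proof -
  have "(\<Sum>k<D. x ^ k / fact k) \<le> (\<Sum>k<D. y ^ k / fact k)"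
    using assms by (intro sum_mono divide_right_mono power_mono) auto
  also have "\<dots> \<le> (\<Sum>k<\<Delta>. y ^ k / fact k)"
    using assms by (intro sum_mono2) auto
  finally show ?thesis by (simp add: poly_gamma_poly)
qed

lemma poly_gamma_poly_ge_1:
  assumes "\<Delta> \<ge> 1" "x \<ge> 0"
  shows "poly (gamma_poly \<Delta>) x \<ge> 1"
  using poly_gamma_poly_mono[of 1 \<Delta> 0 x] assms by (simp add: poly_gamma_poly)

text \<open>From \<open>\<gamma>' \<le> \<gamma>\<close> and \<open>c \<le> 1\<close> the left side
  is at most \<open>2 x\<close>, so \<open>x \<ge> 1 / 2\<close>. Conversely
  \<open>x \<gamma>'(x) \<le> \<gamma>(x)\<close> says that the sum of
  \<open>(k - 1) x^k / k!\<close> is at most 0; its only negative term is \<open>-1\<close>, and the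
  term \<open>k = 2\<close> alone then forces \<open>x^2 \<le> 2\<close>.\<close>

lemma saddle_point_bounds:
  assumes "\<Delta> \<ge> 3" "0 \<le> c" "c \<le> 1" "x > 0"
    and x: "x * poly (pderiv (gamma_poly \<Delta>)) x / poly (gamma_poly \<Delta>) x + x * c = 1"
  shows "1 / 2 \<le> x" "x \<le> 2"
proof -
  let ?g = "gamma_poly \<Delta>"
  have pos: "poly ?g x > 0" using assms by (intro poly_gamma_poly_pos) auto
  have "poly (pderiv ?g) x \<le> poly ?g x"
    unfolding pderiv_gamma_poly using assms by (intro poly_gamma_poly_mono) auto
  then have "x * poly (pderiv ?g) x / poly ?g x \<le> x * 1"
    unfolding times_divide_eq_right[symmetric] using pos assms by (intro mult_left_mono) auto
  moreover have "x * c \<le> x * 1" using assms by (intro mult_left_mono) auto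
  ultimately show "1 / 2 \<le> x" using x by linarith
  have "x * c \<ge> 0" using assms by simp
  then have "x * poly (pderiv ?g) x / poly ?g x \<le> 1" using x by linarith
  then have "x * poly (pderiv ?g) x \<le> poly ?g x" using pos by (simp add: field_simps)
  then have "(\<Sum>k<\<Delta>. (real k - 1) * (x ^ k / fact k)) \<le> 0"
    unfolding pderiv_gamma_poly_moments(1) poly_gamma_poly
    by (simp only: left_diff_distrib sum_subtractf mult_1_left diff_le_0_iff_le)
  moreover have "(\<Sum>k\<in>{0, 2}. (real k - 1) * (x ^ k / fact k)) \<le> (\<Sum>k<\<Delta>. (real k - 1) * (x ^ k / fact k))"
    using assms by (intro sum_mono2) (auto intro!: mult_nonneg_nonneg)
  ultimately have "x\<^sup>2 \<le> 2" by (simp add: fact_numeral)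
  then have "x\<^sup>2 \<le> 2\<^sup>2" by simp
  then show "x \<le> 2" by (rule power2_le_imp_le) simp
qed

text \<open>With \<open>s = x w / n\<close> in the unit interval, \<open>saddle_beta\<close> is
  \<open>x^2 \<gamma>''(x) / \<gamma>(x) + s (2 - s)\<close>. The bounds follow from
  \<open>x\<close> in \<open>[1/2, 2]\<close> and
  \<open>1 \<le> \<gamma>'' \<le> \<gamma>\<close>.\<close>

lemma saddle_beta_bounds:
  assumes "\<Delta> \<ge> 3" "n \<ge> 1" "0 \<le> w" "w \<le> real n" "x > 0"
    and x: "x * poly (pderiv (gamma_poly \<Delta>)) x / poly (gamma_poly \<Delta>) x + x * w / real n = 1"
  shows "1 / (4 * poly (gamma_poly \<Delta>) 2) \<le> saddle_beta \<Delta> n w x" "saddle_beta \<Delta> n w x \<le> 6"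
proof -
  let ?g = "gamma_poly \<Delta>"
  define s where "s = x * w / real n"
  have bounds: "1 / 2 \<le> x" "x \<le> 2"
    using saddle_point_bounds[of \<Delta> "w / real n" x] assms by auto
  have pos: "poly ?g x > 0" using assms by (intro poly_gamma_poly_pos) auto
  have g''1: "poly (pderiv (pderiv ?g)) x \<ge> 1"
    unfolding pderiv_gamma_poly using assms by (intro poly_gamma_poly_ge_1) auto
  have g''g: "poly (pderiv (pderiv ?g)) x \<le> poly ?g x"
    unfolding pderiv_gamma_poly using assms by (intro poly_gamma_poly_mono) auto
  have g2: "poly ?g x \<le> poly ?g 2"
    using assms bounds by (intro poly_gamma_poly_mono) auto
  have "x * poly (pderiv ?g) x / poly ?g x \<ge> 0"
    unfolding pderiv_gamma_poly using assms pos
    by (intro divide_nonneg_pos mult_nonneg_nonneg less_imp_le[OF poly_gamma_poly_pos]) auto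
  then have s: "0 \<le> s" "s \<le> 1"
    using x assms(3,5) unfolding s_def by (simp, linarith)
  have eq: "saddle_beta \<Delta> n w x = x\<^sup>2 * (poly (pderiv (pderiv ?g)) x / poly ?g x) + s * (2 - s)"
    by (simp add: saddle_beta_def s_def power2_eq_square algebra_simps)
  have x2: "(1 / 2)\<^sup>2 \<le> x\<^sup>2" "x\<^sup>2 \<le> 2\<^sup>2" by (rule power_mono; use bounds in simp)+
  have "1 / poly ?g 2 \<le> poly (pderiv (pderiv ?g)) x / poly ?g x"
    using g''1 g2 pos by (intro frac_le) auto
  then have "(1 / 2)\<^sup>2 * (1 / poly ?g 2) \<le> x\<^sup>2 * (poly (pderiv (pderiv ?g)) x / poly ?g x)"
    using x2 pos g2 by (intro mult_mono) auto
  moreover have "s * (2 - s) \<ge> 0" using s by simp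
  ultimately show "1 / (4 * poly ?g 2) \<le> saddle_beta \<Delta> n w x"
    unfolding eq by (simp add: power2_eq_square)
  have "x\<^sup>2 * (poly (pderiv (pderiv ?g)) x / poly ?g x) \<le> 2\<^sup>2 * 1"
    using x2 pos g''1 g''g by (intro mult_mono) auto
  moreover have "s * (2 - s) \<le> 1 * 2" using s by (intro mult_mono) auto
  ultimately show "saddle_beta \<Delta> n w x \<le> 6" unfolding eq by simp
qed

lemma saddle_point_asymptotics:
  fixes r w :: "nat \<Rightarrow> real"
  assumes \<Delta>: "\<Delta> \<ge> 3"
    and w: "\<And>n. n \<ge> 1 \<Longrightarrow> 0 \<le> w n \<and> w n \<le> real n"
    and rpos: "\<And>n. n \<ge> 1 \<Longrightarrow> r n > 0"
    and saddle: "\<And>n. n \<ge> 1 \<Longrightarrow> r n * poly (pderiv (gamma_poly \<Delta>)) (r n) / poly (gamma_poly \<Delta>) (r n)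
      + r n * w n / real n = 1"
  shows "(\<lambda>n. \<Sum>k\<le>n - j. w n ^ k / fact k * coeff (gamma_poly \<Delta> ^ n) (n - j - k)) \<sim>[sequentially]
    (\<lambda>n. poly (gamma_poly \<Delta>) (r n) ^ n * exp (r n * w n) /
      (r n ^ (n - j) * sqrt (2 * pi * saddle_beta \<Delta> n (w n) (r n) * real n)))"
proof -
  let ?g = "gamma_poly \<Delta>"
  define S where "S n = (\<Sum>k\<le>n - j. w n ^ k / fact k * coeff (?g ^ n) (n - j - k))" for n
  define F where "F n = poly ?g (r n) ^ n * exp (r n * w n)" for n
  define s where "s n = r n * w n / real n" for n
  define q where "q n k = r n ^ k / fact k / poly ?g (r n)" for n k
  define \<beta> where "\<beta> n = saddle_beta \<Delta> n (w n) (r n)" for n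
  define \<psi> where "\<psi> n = charfun \<Delta> (q n) (s n)" for n
  \<comment> \<open>From \<open>n0\<close> on, \<open>n - j\<close> is a true difference and not
    truncated.\<close>
  define n0 where "n0 = max 1 j"
  have n0: "n \<ge> 1" "n \<ge> j" if "n \<ge> n0" for n using that by (auto simp: n0_def)
  define P2 where "P2 = poly ?g 2"
  have P2: "P2 > 0" unfolding P2_def using \<Delta> by (intro poly_gamma_poly_pos) auto
  have r: "1 / 2 \<le> r n" "r n \<le> 2" if "n \<ge> 1" for n
    using saddle_point_bounds[OF \<Delta>, of "w n / real n" "r n"] w[OF that] rpos[OF that] saddle[OF that] that
    by auto
  have gpos: "poly ?g (r n) > 0" if "n \<ge> 1" for n
    using \<Delta> rpos[OF that] by (intro poly_gamma_poly_pos) auto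
  have gP2: "poly ?g (r n) \<le> P2" if "n \<ge> 1" for n
    unfolding P2_def using r[OF that] by (intro poly_gamma_poly_mono) auto
  have q_nonneg: "q n k \<ge> 0" if "n \<ge> 1" for n k
    using gpos[OF that] rpos[OF that] by (simp add: q_def)
  have q_sum: "(\<Sum>k<\<Delta>. q n k) = 1" if "n \<ge> 1" for n
  proof -
    have "(\<Sum>k<\<Delta>. q n k) = poly ?g (r n) / poly ?g (r n)"
      unfolding q_def sum_divide_distrib[symmetric] poly_gamma_poly ..
    then show ?thesis using gpos[OF that] by simp
  qed
  have mean: "(\<Sum>k<\<Delta>. real k * q n k) = r n * poly (pderiv ?g) (r n) / poly ?g (r n)" for n
    unfolding pderiv_gamma_poly_moments(1) by (simp add: q_def sum_divide_distrib)
  have mean_s: "(\<Sum>k<\<Delta>. real k * q n k) + s n = 1" if "n \<ge> 1" for n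
    using saddle[OF that] by (simp add: mean s_def)
  have s_nonneg: "s n \<ge> 0" if "n \<ge> 1" for n
    using w[OF that] rpos[OF that] by (simp add: s_def)
  \<comment> \<open>Inserting the saddle equation, by which the mean of \<open>q n\<close> is
    \<open>1 - s n\<close>, shows that \<open>\<beta> n\<close> is the variance of
    \<open>q n\<close> plus the Poisson variance \<open>s n\<close>.\<close>
  have \<beta>_eq: "\<beta> n = (\<Sum>k<\<Delta>. (real k)\<^sup>2 * q n k) - (\<Sum>k<\<Delta>. real k * q n k)\<^sup>2 + s n" if "n \<ge> 1" for n
  proof -
    have "(\<Sum>k<\<Delta>. (real k)\<^sup>2 * q n k) - (\<Sum>k<\<Delta>. real k * q n k)
        = (r n)\<^sup>2 * poly (pderiv (pderiv ?g)) (r n) / poly ?g (r n)"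
      unfolding pderiv_gamma_poly_moments(2) by (simp add: q_def sum_divide_distrib diff_divide_distrib)
    then have "(r n)\<^sup>2 * poly (pderiv (pderiv ?g)) (r n) / poly ?g (r n)
        = (\<Sum>k<\<Delta>. (real k)\<^sup>2 * q n k) - (1 - s n)"
      using mean_s[OF that] by linarith
    moreover have "(\<Sum>k<\<Delta>. real k * q n k) = 1 - s n" using mean_s[OF that] by linarith
    moreover have "\<beta> n = (r n)\<^sup>2 * poly (pderiv (pderiv ?g)) (r n) / poly ?g (r n) + 2 * s n - (s n)\<^sup>2"
      by (simp add: \<beta>_def saddle_beta_def s_def power_mult_distrib power_divide)
    ultimately show ?thesis by (simp add: power2_diff)
  qed
  have \<beta>_bounds: "1 / (4 * P2) \<le> \<beta> n" "\<beta> n \<le> 6" if "n \<ge> 1" for n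
    using saddle_beta_bounds[OF \<Delta> that, of "w n" "r n"] w[OF that] rpos[OF that] saddle[OF that]
    by (auto simp: \<beta>_def P2_def)
  \<comment> \<open>The coefficient divided by the value of its generating function at
    \<open>r n\<close>, up to the power of \<open>r n\<close>: this normalisation turns Cauchy's
    integrand into a power of a characteristic function.\<close>
  define x where "x n = r n ^ (n - j) * S n / F n" for n
  have Fpos: "F n > 0" if "n \<ge> 1" for n using gpos[OF that] by (simp add: F_def)
  have "x \<sim>[sequentially] (\<lambda>n. 1 / sqrt (2 * pi * \<beta> n * real n))"
  proof (rule local_limit_asymp_equiv)
    \<comment> \<open>The product of the atoms 0 and 1 of \<open>q n\<close> is
      \<open>r n / \<gamma>(r n)^2\<close>, at least \<open>1 / (2 P2^2)\<close>; the 12 is that of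
      \<open>cos_le_quadratic\<close>. The second constant comes from
      \<open>saddle_beta_bounds\<close>.\<close>
    show "1 / (2 * P2\<^sup>2) / 12 > 0" "1 / (4 * P2) > 0" using P2 by simp_all
    show "n0 \<ge> 1" by (simp add: n0_def)
    fix n assume "n \<ge> n0"
    then have n: "n \<ge> 1" "n \<ge> j" using n0 by auto
    show "1 / (4 * P2) \<le> \<beta> n" "\<beta> n \<le> 6" by (rule \<beta>_bounds[OF n(1)])+
    show "continuous_on UNIV (\<psi> n)"
      unfolding \<psi>_def charfun_def by (intro continuous_intros)
    show "cmod (\<psi> n \<theta>) \<le> exp (- (1 / (2 * P2\<^sup>2) / 12 * \<theta>\<^sup>2))" if "\<bar>\<theta>\<bar> \<le> pi" for \<theta>
    proof -
      have "1 / (2 * P2\<^sup>2) \<le> q n 0 * q n 1"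
      proof -
        have "(1 / 2) / P2\<^sup>2 \<le> r n / (poly ?g (r n))\<^sup>2"
          using r[OF n(1)] gpos[OF n(1)] gP2[OF n(1)] by (intro frac_le power_mono) auto
        then show ?thesis by (simp add: q_def power2_eq_square)
      qed
      then have "1 / (2 * P2\<^sup>2) * (\<theta>\<^sup>2 / 12) \<le> q n 0 * q n 1 * (1 - cos \<theta>)"
        using cos_le_quadratic[OF that] q_nonneg[OF n(1)] by (intro mult_mono) auto
      then have "exp (- (q n 0 * q n 1 * (1 - cos \<theta>))) \<le> exp (- (1 / (2 * P2\<^sup>2) / 12 * \<theta>\<^sup>2))" by simp
      moreover have "cmod (\<psi> n \<theta>) \<le> exp (- (q n 0 * q n 1 * (1 - cos \<theta>)))"
        unfolding \<psi>_def using \<Delta> n by (intro norm_charfun_le s_nonneg q_nonneg q_sum) auto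
      ultimately show ?thesis by linarith
    qed
    show "cmod (\<psi> n \<theta> - of_real (exp (- (\<beta> n * \<theta>\<^sup>2 / 2)))) \<le> (2 * real \<Delta> ^ 3 +
        exp (real \<Delta> ^ 2) * (real \<Delta> + real \<Delta> ^ 2) ^ 3 + real \<Delta> ^ 4 + 1) * \<bar>\<theta>\<bar> ^ 3" if "\<bar>\<theta>\<bar> \<le> 1" for \<theta>
      unfolding \<psi>_def using n that by (intro charfun_approx s_nonneg q_nonneg q_sum mean_s \<beta>_eq) auto
    show "((\<lambda>t. \<psi> n t ^ n * cis (real j * t)) has_integral of_real (2 * pi * x n)) {-pi..pi}"
    proof -
      have "((\<lambda>t. complex_of_real (1 / F n) * ((\<Sum>k<\<Delta>. (of_real (r n) * cis t) ^ k / fact k) ^ n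
          * exp (of_real (w n) * (of_real (r n) * cis t)) * cis (- (real (n - j) * t)))) has_integral
          complex_of_real (1 / F n) * complex_of_real (2 * pi * r n ^ (n - j) * S n)) {-pi..pi}"
        unfolding S_def by (intro has_integral_mult_right coeff_gamma_poly_power_exp_integral rpos n)
      moreover have "complex_of_real (1 / F n) * ((\<Sum>k<\<Delta>. (of_real (r n) * cis t) ^ k / fact k) ^ n
          * exp (of_real (w n) * (of_real (r n) * cis t)) * cis (- (real (n - j) * t))) =
          \<psi> n t ^ n * cis (real j * t)" for t
      proof -
        define A where "A = (\<Sum>k<\<Delta>. (of_real (r n) * cis t) ^ k / fact k)"
        define G where "G = complex_of_real (poly ?g (r n))"
        have sum_q: "(\<Sum>k<\<Delta>. of_real (q n k) * cis (real k * t)) = A / G"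
          unfolding A_def G_def sum_divide_distrib
          by (intro sum.cong) (simp_all add: q_def power_mult_distrib Complex.DeMoivre)
        have e: "exp (of_real (s n) * (cis t - 1)) ^ n =
            exp (of_real (w n) * (of_real (r n) * cis t)) / exp (of_real (r n * w n))"
        proof -
          have "of_nat n * (of_real (s n) * (cis t - 1)) =
              of_real (w n) * (of_real (r n) * cis t) - of_real (r n * w n)"
          proof -
            have "of_nat n * complex_of_real (s n) = of_real (r n * w n)"
              using n(1) by (simp add: s_def)
            then have "of_nat n * (of_real (s n) * (cis t - 1)) = of_real (r n * w n) * (cis t - 1)"
              by (simp only: mult.assoc[symmetric])
            then show ?thesis by (simp add: algebra_simps)
          qed
          then show ?thesis by (simp add: exp_of_nat_mult[symmetric] exp_diff)
        qed
        \<comment> \<open>The shift by \<open>-1\<close> in each of the \<open>n\<close> factors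
          accounts for the exponent \<open>n\<close>; the coefficient has index
          \<open>n - j\<close>, and the discrepancy is the fixed factor allowed for in the local
          limit theorem.\<close>
        have c: "cis (- t) ^ n * cis (real j * t) = cis (- (real (n - j) * t))"
          using n(2) by (simp add: Complex.DeMoivre cis_mult of_nat_diff algebra_simps)
        have "\<psi> n t ^ n * cis (real j * t) =
            (A / G) ^ n * exp (of_real (s n) * (cis t - 1)) ^ n * (cis (- t) ^ n * cis (real j * t))"
          unfolding \<psi>_def charfun_def sum_q power_mult_distrib by (simp only: mult.assoc)
        also have "\<dots> = A ^ n * exp (of_real (w n) * (of_real (r n) * cis t)) * cis (- (real (n - j) * t))
            / (G ^ n * exp (of_real (r n * w n)))"
          unfolding e c by (simp add: power_divide)
        also have "G ^ n * exp (of_real (r n * w n)) = of_real (F n)"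
          by (simp add: G_def F_def exp_of_real[symmetric])
        finally show ?thesis by (simp add: A_def)
      qed
      ultimately show ?thesis by (simp add: x_def mult.assoc)
    qed
  qed
  then have "(\<lambda>n. x n * (F n / r n ^ (n - j))) \<sim>[sequentially]
      (\<lambda>n. 1 / sqrt (2 * pi * \<beta> n * real n) * (F n / r n ^ (n - j)))"
    by (intro asymp_equiv_intros)
  moreover have "eventually (\<lambda>n. x n * (F n / r n ^ (n - j)) = S n) sequentially"
    using eventually_ge_at_top[of "1::nat"]
  proof eventually_elim
    case (elim n)
    then show ?case using rpos[OF elim] Fpos[OF elim] by (simp add: x_def)
  qed
  then have "S \<sim>[sequentially] (\<lambda>n. x n * (F n / r n ^ (n - j)))"
    by (intro asymp_equiv_refl_ev) (simp add: eq_commute)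
  ultimately have "S \<sim>[sequentially] (\<lambda>n. F n / (r n ^ (n - j) * sqrt (2 * pi * \<beta> n * real n)))"
    by (simp add: mult.commute asymp_equiv_trans[of S])
  then show ?thesis
    unfolding S_def[abs_def] F_def \<beta>_def .
qed

section \<open>From coefficients to the two counts\<close>

lemma saddle_props:
  assumes "\<Delta> \<ge> 3" "w > 0"
  shows "saddle \<Delta> n w > 0"
    "saddle \<Delta> n w * poly (pderiv (gamma_poly \<Delta>)) (saddle \<Delta> n w) / poly (gamma_poly \<Delta>) (saddle \<Delta> n w)
      + saddle \<Delta> n w * w / real n = 1"
  using theI'[OF saddle_ex1[OF assms, of n]] unfolding saddle_def by blast+

lemma alpha_props:
  assumes "\<Delta> \<ge> 3"
  shows "alpha \<Delta> > 1"
    "alpha \<Delta> * poly (gamma_poly (\<Delta> - 1)) (alpha \<Delta>) / poly (gamma_poly \<Delta>) (alpha \<Delta>) = 1"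
  using theI'[OF alpha_ex1[OF assms]] unfolding alpha_def by blast+

text \<open>With \<open>k = m - 1\<close>, the factor \<open>1 / (m - 1)!\<close> of the forest
  count turns the weights into an exponential series, with one factor \<open>w\<close> left
  over.\<close>

lemma sum_forest_count_eq:
  assumes "\<Delta> \<ge> 1" "n \<ge> 1"
  shows "(\<Sum>m = 1..n. real (forest_count \<Delta> n m) * w ^ m) =
    w * fact (n - 1) * (\<Sum>k\<le>n - 1. w ^ k / fact k * coeff (gamma_poly \<Delta> ^ n) (n - 1 - k))"
proof -
  have "(\<Sum>m = 1..n. real (forest_count \<Delta> n m) * w ^ m) =
      (\<Sum>m = 1..n. fact (n - 1) / fact (m - 1) * coeff (gamma_poly \<Delta> ^ n) (n - m) * w ^ m)"
    using forest_count_eq[OF assms(1)] by (intro sum.cong) auto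
  also have "\<dots> = (\<Sum>k\<le>n - 1. fact (n - 1) / fact k * coeff (gamma_poly \<Delta> ^ n) (n - 1 - k) * w ^ Suc k)"
    using assms(2) by (intro sum.reindex_bij_witness[of _ Suc "\<lambda>m. m - 1"]) auto
  also have "\<dots> = w * fact (n - 1) * (\<Sum>k\<le>n - 1. w ^ k / fact k * coeff (gamma_poly \<Delta> ^ n) (n - 1 - k))"
    unfolding sum_distrib_left by (intro sum.cong) auto
  finally show ?thesis .
qed

section \<open>Stirling's formula and its shift by two\<close>

text \<open>The quantity \<open>n^n exp(-n) / n!\<close> is the probability that a sum of
  \<open>n\<close> independent Poisson variables of mean 1 equals its mean \<open>n\<close>.\<close>

lemma fact_asymp_equiv: "fact \<sim>[sequentially] (\<lambda>n. sqrt (2 * pi * real n) * (real n / exp 1) ^ n)"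
proof -
  define x where "x n = (real n / exp 1) ^ n / fact n" for n :: nat
  \<comment> \<open>Here \<open>X\<close> is constantly 0 and the Poisson part has mean and variance
    1.\<close>
  define \<psi> where "\<psi> = charfun 1 (\<lambda>_. 1) 1"
  have \<psi>: "\<psi> \<theta> = exp (cis \<theta> - 1) * cis (- \<theta>)" for \<theta>
    by (simp add: \<psi>_def charfun_def)
  have "x \<sim>[sequentially] (\<lambda>n. 1 / sqrt (2 * pi * 1 * real n))"
  proof (rule local_limit_asymp_equiv)
    show "(1 / 12 :: real) > 0" "(1 :: real) > 0" "(1 :: nat) \<ge> 1" by simp_all
    fix n :: nat assume n: "n \<ge> 1"
    show "(1 :: real) \<le> 1" "(1 :: real) \<le> 1" by simp_all
    show "continuous_on UNIV \<psi>"
      unfolding \<psi>_def charfun_def by (intro continuous_intros)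
    \<comment> \<open>As \<open>X\<close> has a single atom, \<open>norm_charfun_le\<close> is of no
      help; the decay comes from the Poisson factor, whose norm is
      \<open>exp (cos \<theta> - 1)\<close>.\<close>
    show "cmod (\<psi> \<theta>) \<le> exp (- (1 / 12 * \<theta>\<^sup>2))" if "\<bar>\<theta>\<bar> \<le> pi" for \<theta>
      using cos_le_quadratic[OF that] by (simp add: \<psi> norm_mult)
    show "cmod (\<psi> \<theta> - of_real (exp (- (1 * \<theta>\<^sup>2 / 2)))) \<le> (2 * real 1 ^ 3 +
        exp (real 1 ^ 2) * (real 1 + real 1 ^ 2) ^ 3 + real 1 ^ 4 + 1) * \<bar>\<theta>\<bar> ^ 3" if "\<bar>\<theta>\<bar> \<le> 1" for \<theta>
      unfolding \<psi>_def by (rule charfun_approx) (use that in simp_all)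
    \<comment> \<open>Cauchy's formula on the unit circle for the coefficient
      \<open>n^n / n!\<close> of \<open>exp(n x)\<close>; no shift occurs, so
      \<open>j = 0\<close>.\<close>
    have "((\<lambda>t. exp (- of_nat n) * (exp (of_nat n * (of_real 1 * cis t)) * cis (- (real n * t)))) has_integral
        exp (- of_nat n) * (of_real (2 * pi * 1 ^ n) * fps_nth (fps_exp (of_nat n :: complex)) n)) {-pi..pi}"
      by (intro has_integral_mult_right coeff_has_integral fps_expansion_intros holomorphic_intros) simp
    moreover have "exp (- of_nat n) * (exp (of_nat n * (of_real 1 * cis t)) * cis (- (real n * t))) =
        \<psi> t ^ n * cis (real 0 * t)" for t
    proof -
      have "exp (cis t - 1) ^ n = exp (of_nat n * (cis t - 1))"
        by (rule exp_of_nat_mult[symmetric])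
      also have "of_nat n * (cis t - 1) = - of_nat n + of_nat n * cis t"
        by (simp add: algebra_simps)
      also have "exp \<dots> = exp (- of_nat n) * exp (of_nat n * cis t)"
        by (rule exp_add)
      finally show ?thesis
        by (simp add: \<psi> power_mult_distrib Complex.DeMoivre)
    qed
    moreover have "exp (- of_nat n) * (of_real (2 * pi * 1 ^ n) * fps_nth (fps_exp (of_nat n :: complex)) n) =
        of_real (2 * pi * x n)"
    proof -
      have "exp (- of_nat n) = complex_of_real (exp (- real n))"
        by (simp add: exp_of_real[symmetric])
      also have "exp (- real n) = 1 / exp 1 ^ n"
        by (simp add: exp_minus divide_inverse exp_of_nat_mult[symmetric])
      finally show ?thesis by (simp add: x_def power_divide)
    qed
    ultimately show "((\<lambda>t. \<psi> t ^ n * cis (real 0 * t)) has_integral of_real (2 * pi * x n)) {-pi..pi}"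
      by simp
  qed
  then have "(\<lambda>n. (real n / exp 1) ^ n / x n) \<sim>[sequentially] (\<lambda>n. (real n / exp 1) ^ n / (1 / sqrt (2 * pi * 1 * real n)))"
    by (intro asymp_equiv_intros)
  moreover have "eventually (\<lambda>n. fact n = (real n / exp 1) ^ n / x n) sequentially"
    using eventually_ge_at_top[of "1::nat"] by eventually_elim (simp add: x_def)
  then have "fact \<sim>[sequentially] (\<lambda>n. (real n / exp 1) ^ n / x n)"
    by (rule asymp_equiv_refl_ev)
  ultimately show ?thesis
    by (simp add: mult.commute asymp_equiv_trans[of fact])
qed

lemma fact_minus_two_asymp:
  "(\<lambda>n. fact (n - 2)) \<sim>[sequentially] (\<lambda>n. sqrt (2 * pi * real n) * (real n / exp 1) ^ n / real n ^ 2)"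
proof -
  have "(\<lambda>n. fact n / (real n ^ 2)) \<sim>[sequentially] (\<lambda>n. sqrt (2 * pi * real n) * (real n / exp 1) ^ n / real n ^ 2)"
    by (intro asymp_equiv_intros fact_asymp_equiv)
  moreover have "(\<lambda>n. fact (n - 2) :: real) \<sim>[sequentially] (\<lambda>n. fact n / (real n ^ 2))"
  proof -
    have "(\<lambda>n. fact (n - 2) * (real n * (real n - 1))) \<sim>[sequentially] (\<lambda>n. fact n :: real)"
    proof (rule asymp_equiv_refl_ev, use eventually_ge_at_top[of "2::nat"] in eventually_elim)
      case (elim n)
      then obtain k where "n = Suc (Suc k)" by (metis add_2_eq_Suc le_Suc_ex)
      then show ?case by simp
    qed
    moreover have "(\<lambda>n. real n * (real n - 1)) \<sim>[sequentially] (\<lambda>n. real n ^ 2)"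
      by real_asymp
    ultimately have "(\<lambda>n. fact (n - 2) * (real n * (real n - 1)) / (real n * (real n - 1)))
        \<sim>[sequentially] (\<lambda>n. fact n / (real n ^ 2))"
      by (intro asymp_equiv_intros)
    then show ?thesis
      by (rule asymp_equiv_trans[rotated], intro asymp_equiv_refl_ev)
         (use eventually_ge_at_top[of "2::nat"] in eventually_elim, auto)
  qed
  ultimately show ?thesis by (rule asymp_equiv_trans[rotated])
qed

theorem theorem3:
  fixes \<Delta> :: nat and w :: "nat \<Rightarrow> real"
  assumes "\<Delta> \<ge> 3"
    and "\<And>n. n \<ge> 1 \<Longrightarrow> 0 < w n \<and> w n \<le> real n"
  shows
    "(\<lambda>n. real (tree_count \<Delta> n)) \<sim>[sequentially]
       (\<lambda>n. alpha \<Delta> * sqrt (poly (gamma_poly \<Delta>) (alpha \<Delta>) / poly (gamma_poly (\<Delta> - 2)) (alpha \<Delta>))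
              * (a_const \<Delta> / exp 1) ^ n * real n ^ (n - 2))
     \<and>
     (\<lambda>n. \<Sum>m = 1..n. real (forest_count \<Delta> n m) * w n ^ m) \<sim>[sequentially]
       (\<lambda>n. let r = saddle \<Delta> n (w n) in
              w n * (fact (n - 1) / r ^ (n - 1))
              * (poly (gamma_poly \<Delta>) r ^ n * exp (r * w n) / sqrt (2 * pi * saddle_beta \<Delta> n (w n) r * real n)))"
proof
  let ?g = "gamma_poly \<Delta>" and ?\<alpha> = "alpha \<Delta>"
  \<comment> \<open>As \<open>\<gamma>_\<Delta>' = \<gamma>_(\<Delta> - 1)\<close>, the defining
    equation of \<open>alpha\<close> is the saddle equation for \<open>w = 0\<close>.\<close>
  have \<alpha>: "?\<alpha> > 0" "?\<alpha> * poly (pderiv ?g) ?\<alpha> / poly ?g ?\<alpha> = 1"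
    unfolding pderiv_gamma_poly using alpha_props[OF assms(1)] by linarith+
  have g\<alpha>: "poly ?g ?\<alpha> > 0" and g2\<alpha>: "poly (gamma_poly (\<Delta> - 2)) ?\<alpha> > 0"
    using assms(1) \<alpha>(1) by (intro poly_gamma_poly_pos; simp)+
  \<comment> \<open>This identity is how \<open>a_const\<close> enters:
    \<open>\<gamma>(\<alpha>)^n / \<alpha>^(n - 2)\<close> becomes \<open>\<alpha>^2\<close> times
    the \<open>n\<close>-th power of \<open>a_const\<close>.\<close>
  have g_eq: "poly ?g ?\<alpha> = ?\<alpha> * a_const \<Delta>"
    using \<alpha>(2) g\<alpha> by (simp add: a_const_def pderiv_gamma_poly)
  define \<beta> where "\<beta> = ?\<alpha>\<^sup>2 * poly (gamma_poly (\<Delta> - 2)) ?\<alpha> / poly ?g ?\<alpha>"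
  have \<beta>: "\<beta> > 0" using \<alpha>(1) g\<alpha> g2\<alpha> by (simp add: \<beta>_def)
  have "pderiv (pderiv ?g) = gamma_poly (\<Delta> - 2)"
    by (simp add: pderiv_gamma_poly numeral_2_eq_2)
  then have \<beta>_eq: "saddle_beta \<Delta> n 0 ?\<alpha> = \<beta>" for n
    by (simp add: saddle_beta_def \<beta>_def)
  \<comment> \<open>As \<open>0^0 = 1\<close>, exactly the term \<open>k = 0\<close>
    survives.\<close>
  have sum0: "(\<Sum>k\<le>N. 0 ^ k / fact k * coeff p (N - k)) = coeff p N" for N and p :: "real poly"
    by (subst sum.mono_neutral_right[of _ "{0}"]) auto
  have "(\<lambda>n. \<Sum>k\<le>n - 2. 0 ^ k / fact k * coeff (?g ^ n) (n - 2 - k)) \<sim>[sequentially]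
      (\<lambda>n. poly ?g ?\<alpha> ^ n * exp (?\<alpha> * 0) / (?\<alpha> ^ (n - 2) * sqrt (2 * pi * saddle_beta \<Delta> n 0 ?\<alpha> * real n)))"
    by (rule saddle_point_asymptotics[where w = "\<lambda>_. 0" and r = "\<lambda>_. ?\<alpha>"]) (use assms(1) \<alpha> in auto)
  then have coeff_asymp: "(\<lambda>n. coeff (?g ^ n) (n - 2)) \<sim>[sequentially]
      (\<lambda>n. poly ?g ?\<alpha> ^ n / (?\<alpha> ^ (n - 2) * sqrt (2 * pi * \<beta> * real n)))"
    unfolding sum0 \<beta>_eq by simp
  have "(\<lambda>n. real (tree_count \<Delta> n)) \<sim>[sequentially] (\<lambda>n. fact (n - 2) * coeff (?g ^ n) (n - 2))"
    by (rule asymp_equiv_refl_ev, use eventually_ge_at_top[of "2::nat"] in eventually_elim)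
       (use tree_count_eq[of \<Delta>] assms(1) in simp)
  also have "\<dots> \<sim>[sequentially] (\<lambda>n. sqrt (2 * pi * real n) * (real n / exp 1) ^ n / real n ^ 2 *
      (poly ?g ?\<alpha> ^ n / (?\<alpha> ^ (n - 2) * sqrt (2 * pi * \<beta> * real n))))"
    by (intro asymp_equiv_mult fact_minus_two_asymp coeff_asymp)
  also have "\<dots> \<sim>[sequentially] (\<lambda>n. ?\<alpha> * sqrt (poly ?g ?\<alpha> / poly (gamma_poly (\<Delta> - 2)) ?\<alpha>)
              * (a_const \<Delta> / exp 1) ^ n * real n ^ (n - 2))"
  proof (rule asymp_equiv_refl_ev, use eventually_ge_at_top[of "2::nat"] in eventually_elim)
    case (elim n)
    then obtain k where k: "n = k + 2" by (metis le_Suc_ex add.commute)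
    define N where "N = real n"
    have N: "N > 0" using elim by (simp add: N_def)
    have 1: "sqrt (2 * pi * N) / sqrt (2 * pi * \<beta> * N) = 1 / sqrt \<beta>"
      using N \<beta> by (simp add: real_sqrt_mult field_simps)
    have 2: "(N / exp 1) ^ n / N ^ 2 = N ^ (n - 2) / exp 1 ^ n"
      using N by (simp add: k power_add power_divide power2_eq_square)
    have 3: "poly ?g ?\<alpha> ^ n / ?\<alpha> ^ (n - 2) = ?\<alpha>\<^sup>2 * a_const \<Delta> ^ n"
      using \<alpha>(1) by (simp add: k g_eq power_add power_mult_distrib power2_eq_square)
    have 4: "?\<alpha>\<^sup>2 * (1 / sqrt \<beta>) = ?\<alpha> * sqrt (poly ?g ?\<alpha> / poly (gamma_poly (\<Delta> - 2)) ?\<alpha>)"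
      using \<alpha>(1) g\<alpha> g2\<alpha> by (simp add: \<beta>_def real_sqrt_mult real_sqrt_divide power2_eq_square)
    have "sqrt (2 * pi * N) * (N / exp 1) ^ n / N ^ 2 * (poly ?g ?\<alpha> ^ n / (?\<alpha> ^ (n - 2) * sqrt (2 * pi * \<beta> * N)))
        = (sqrt (2 * pi * N) / sqrt (2 * pi * \<beta> * N)) * ((N / exp 1) ^ n / N ^ 2) * (poly ?g ?\<alpha> ^ n / ?\<alpha> ^ (n - 2))"
      by (simp add: field_simps)
    also have "\<dots> = (?\<alpha>\<^sup>2 * (1 / sqrt \<beta>)) * (a_const \<Delta> ^ n / exp 1 ^ n) * N ^ (n - 2)"
      unfolding 1 2 3 by (simp add: field_simps)
    finally show ?case unfolding 4 by (simp add: N_def power_divide)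
  qed
  finally show "(\<lambda>n. real (tree_count \<Delta> n)) \<sim>[sequentially]
       (\<lambda>n. ?\<alpha> * sqrt (poly ?g ?\<alpha> / poly (gamma_poly (\<Delta> - 2)) ?\<alpha>)
              * (a_const \<Delta> / exp 1) ^ n * real n ^ (n - 2))" .
next
  let ?g = "gamma_poly \<Delta>"
  define r where "r n = saddle \<Delta> n (w n)" for n
  define S where "S n = (\<Sum>k\<le>n - 1. w n ^ k / fact k * coeff (?g ^ n) (n - 1 - k))" for n
  define A where "A n = poly ?g (r n) ^ n * exp (r n * w n) /
      (r n ^ (n - 1) * sqrt (2 * pi * saddle_beta \<Delta> n (w n) (r n) * real n))" for n
  have "S \<sim>[sequentially] A"
    unfolding S_def[abs_def] A_def[abs_def]
    using assms saddle_props[OF assms(1)]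
    by (intro saddle_point_asymptotics) (auto simp: r_def less_imp_le)
  then have *: "(\<lambda>n. w n * fact (n - 1) * S n) \<sim>[sequentially] (\<lambda>n. w n * fact (n - 1) * A n)"
    by (intro asymp_equiv_intros)
  have "(\<lambda>n. \<Sum>m = 1..n. real (forest_count \<Delta> n m) * w n ^ m) \<sim>[sequentially] (\<lambda>n. w n * fact (n - 1) * S n)"
    by (rule asymp_equiv_refl_ev, use eventually_ge_at_top[of "1::nat"] in eventually_elim)
       (use sum_forest_count_eq[of \<Delta>] assms(1) in \<open>simp add: S_def\<close>)
  also note *
  also have "(\<lambda>n. w n * fact (n - 1) * A n) = (\<lambda>n. let r = saddle \<Delta> n (w n) in
              w n * (fact (n - 1) / r ^ (n - 1))
              * (poly ?g r ^ n * exp (r * w n) / sqrt (2 * pi * saddle_beta \<Delta> n (w n) r * real n)))"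
    by (simp add: A_def r_def Let_def fun_eq_iff)
  finally show "(\<lambda>n. \<Sum>m = 1..n. real (forest_count \<Delta> n m) * w n ^ m) \<sim>[sequentially] (\<lambda>n. let r = saddle \<Delta> n (w n) in
              w n * (fact (n - 1) / r ^ (n - 1))
              * (poly ?g r ^ n * exp (r * w n) / sqrt (2 * pi * saddle_beta \<Delta> n (w n) r * real n)))" .
qed

end
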